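(* Let $N_{\mathsf s}\ge1$ be a fixed integer, $\beta\in(0,\infty)$, $\gamma>0$, and for each integer $N_{\mathsf h}\ge1$ set $N=N_{\mathsf s}N_{\mathsf h}$ and let $K=K_N$ with $K_N/N\to\beta$. Let $\boldsymbol{S}=[\boldsymbol{s}_1,\dots,\boldsymbol{s}_K]\in\mathbb{R}^{N\times K}$ have independent columns, each an $(N_{\mathsf s},N_{\mathsf h})$-sequence. Consider $\boldsymbol{y}=\boldsymbol{S}\boldsymbol{b}+\boldsymbol{n}$ with $\boldsymbol{b}=(\mathsf b_1,\dots,\mathsf b_K)$ having i.i.d. $\mathcal{CN}(0,\mathcal E)$ entries, $\boldsymbol{n}\sim\mathcal{CN}(\boldsymbol 0,\mathcal N_0\boldsymbol I_N)$, $\boldsymbol b,\boldsymbol n,\boldsymbol S$ independent, and $\gamma=\mathcal E/\mathcal N_0$. Let $\mathsf y_1=\boldsymbol{s}_1^{\mathsf T}\boldsymbol{y}$ be the output of the single-user matched filter of user 1. Then, as $N\to\infty$, \[ \beta\, I(\mathsf y_1;\mathsf b_1\mid \boldsymbol S)\ \to\ I^{\mathsf{sumf}}_{\mathrm{TH}}(\beta,\gamma,N_{\mathsf s}):=\beta\sum_{k\ge0}\frac{(N_{\mathsf s}^2\beta)^k}{k!}e^{-N_{\mathsf s}^2\beta}\log_2\!\Big(1+\frac{\gamma}{1+\frac{k}{N_{\mathsf s}^2}\gamma}\Big), \] where mutual information is measured in bits.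
   Context: An $(N_{\mathsf s},N_{\mathsf h})$-sequence is a random vector $\boldsymbol{s}\in\mathbb{R}^N$, $N=N_{\mathsf s}N_{\mathsf h}$, such that for each $m=1,\dots,N_{\mathsf s}$ the block $(s_{1+(m-1)N_{\mathsf h}},\dots,s_{mN_{\mathsf h}})$ has exactly one nonzero entry, whose position within the block is uniform and whose value is $\pm1/\sqrt{N_{\mathsf s}}$ with equal probability, all choices independent. $\mathcal{CN}(\mu,\sigma^2)$ denotes the circularly symmetric complex Gaussian distribution. The quantity $\beta I(\mathsf y_1;\mathsf b_1\mid\boldsymbol S)$ is the sum mutual information per chip (b/s/Hz) for a bank of single-user matched filters followed by independent decoders each knowing $\boldsymbol S$. *)

theory Defs
  imports "HOL-Probability.Probability"
begin

definition CN0 :: "real \<Rightarrow> complex measure" where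
  "CN0 s2 = density lborel (\<lambda>z. ennreal (exp (- (cmod z)\<^sup>2 / s2) / (pi * s2)))"

text \<open>An (Ns,Nh)-sequence, 0-based indices i < Ns*Nh; block m consists of the
  indices i with i div Nh = m. The choice for block m is a pair (position within
  block, sign).\<close>
definition seq_of :: "nat \<Rightarrow> nat \<Rightarrow> (nat \<Rightarrow> nat \<times> bool) \<Rightarrow> nat \<Rightarrow> real" where
  "seq_of Ns Nh c i =
     (if i < Ns * Nh \<and> i mod Nh = fst (c (i div Nh))
      then (if snd (c (i div Nh)) then 1 else -1) / sqrt (real Ns) else 0)"

definition NsNh_seq :: "nat \<Rightarrow> nat \<Rightarrow> (nat \<Rightarrow> real) pmf" where
  "NsNh_seq Ns Nh = map_pmf (seq_of Ns Nh)
     (Pi_pmf {..<Ns} (0, True) (\<lambda>_. pair_pmf (pmf_of_set {..<Nh}) (pmf_of_set (UNIV :: bool set))))"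

text \<open>Random spreading matrix: columns j < K independent (Ns,Nh)-sequences;
  the matrix is represented as the function j \<mapsto> column j (entry S_{i,j} = cols j i).\<close>
definition spread_pmf :: "nat \<Rightarrow> nat \<Rightarrow> nat \<Rightarrow> (nat \<Rightarrow> nat \<Rightarrow> real) pmf" where
  "spread_pmf Ns Nh K = Pi_pmf {..<K} (\<lambda>_. 0) (\<lambda>_. NsNh_seq Ns Nh)"

definition cdma_space :: "nat \<Rightarrow> nat \<Rightarrow> nat \<Rightarrow> real \<Rightarrow> real \<Rightarrow>
    ((nat \<Rightarrow> nat \<Rightarrow> real) \<times> ((nat \<Rightarrow> complex) \<times> (nat \<Rightarrow> complex))) measure" where
  "cdma_space Ns Nh K E N0 =
     measure_pmf (spread_pmf Ns Nh K) \<Otimes>\<^sub>M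
       (PiM {..<K} (\<lambda>_. CN0 E) \<Otimes>\<^sub>M PiM {..<Ns * Nh} (\<lambda>_. CN0 N0))"

definition rx :: "nat \<Rightarrow> nat \<Rightarrow> nat \<Rightarrow>
    (nat \<Rightarrow> nat \<Rightarrow> real) \<times> ((nat \<Rightarrow> complex) \<times> (nat \<Rightarrow> complex)) \<Rightarrow> nat \<Rightarrow> complex" where
  "rx Ns Nh K \<omega> i = (let (S, b, n) = \<omega> in (\<Sum>j<K. of_real (S j i) * b j) + n i)"

definition mf_out :: "nat \<Rightarrow> nat \<Rightarrow> nat \<Rightarrow>
    (nat \<Rightarrow> nat \<Rightarrow> real) \<times> ((nat \<Rightarrow> complex) \<times> (nat \<Rightarrow> complex)) \<Rightarrow> complex" where
  "mf_out Ns Nh K \<omega> = (\<Sum>i<Ns * Nh. of_real (fst \<omega> 0 i) * rx Ns Nh K \<omega> i)"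

definition sym1 :: "(nat \<Rightarrow> nat \<Rightarrow> real) \<times> ((nat \<Rightarrow> complex) \<times> (nat \<Rightarrow> complex)) \<Rightarrow> complex" where
  "sym1 \<omega> = fst (snd \<omega>) 0"

text \<open>I(y_1; b_1 | S) in bits, via the library's conditional mutual information;
  S is discrete (finitely many values), measured with the counting measure on its support.\<close>
definition MI_mf :: "nat \<Rightarrow> nat \<Rightarrow> nat \<Rightarrow> real \<Rightarrow> real \<Rightarrow> real" where
  "MI_mf Ns Nh K E N0 =
     prob_space.conditional_mutual_information (cdma_space Ns Nh K E N0) 2
       (borel :: complex measure) (borel :: complex measure)
       (count_space (set_pmf (spread_pmf Ns Nh K)))
       (mf_out Ns Nh K) sym1 fst"

definition I_sumf_TH :: "real \<Rightarrow> real \<Rightarrow> nat \<Rightarrow> real" where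
  "I_sumf_TH \<beta> \<gamma> Ns = \<beta> * (\<Sum>k. ((real Ns)\<^sup>2 * \<beta>) ^ k / fact k * exp (- ((real Ns)\<^sup>2 * \<beta>))
       * log 2 (1 + \<gamma> / (1 + real k / (real Ns)\<^sup>2 * \<gamma>)))"

end

theory Submission
  imports Defs
begin

text \<open>
  Given \<open>S\<close>, the matched filter output is \<open>b\<^sub>1\<close> plus an independent circular Gaussian of variance
  \<open>N0 + E * Q\<close>, where \<open>Q\<close> is the sum of the squared correlations of the first signature with the
  others. Hence \<open>I(y\<^sub>1; b\<^sub>1 | S)\<close> is the expectation of \<open>log 2 (1 + \<gamma> / (1 + \<gamma> * Q))\<close>. For a fixed
  first signature the correlations are independent and identically distributed, so the Laplace
  transform of \<open>Q\<close> is a \<open>(K - 1)\<close>-st power. A correlation is nonzero with probability about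
  \<open>Ns / Nh\<close>, and then equals \<open>1 / Ns\<close> in absolute value up to an event of probability
  \<open>O(1 / Nh\<^sup>2)\<close>. The Laplace transform of \<open>Q\<close> therefore converges to that of \<open>P / Ns\<^sup>2\<close> with \<open>P\<close>
  Poisson of mean \<open>Ns\<^sup>2 * \<beta>\<close>, which suffices because the integrand is continuous in \<open>Q\<close> and
  vanishes at infinity.
\<close>

section \<open>Circularly symmetric complex Gaussians\<close>

text \<open>Two obstacles shape the proof. Conditional mutual information is a difference of two
  mutual informations, on a space mixing complex and discrete coordinates. Both integrands must be
  integrable before they are combined, although the density of the output is a mixture over all
  states whose logarithm has no closed form. That logarithm is only bounded; it cancels in the
  difference. In the limit, the correlations are independent only after the first signature is
  fixed, so the estimate for one interferer has to be uniform in that signature. Its error of order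
  \<open>1 / Nh\<^sup>2\<close> is multiplied by \<open>K - 1\<close>, which is of order
  \<open>Nh\<close>, and still vanishes. The Poisson mean comes from
  \<open>(K - 1) * (Ns / Nh)\<close>, since \<open>K / (Ns * Nh)\<close> tends to \<beta>. Laplace
  transforms are needed only at natural arguments, where \<open>exp (- (k * Q))\<close> is a power
  of \<open>exp (- Q)\<close>.\<close>

definition CN_density :: "real \<Rightarrow> complex \<Rightarrow> real" where
  "CN_density s z = exp (- (cmod z)\<^sup>2 / s) / (pi * s)"

lemma CN_density_pos: "s > 0 \<Longrightarrow> CN_density s z > 0"
  by (simp add: CN_density_def)

lemma CN_density_nonneg: "s > 0 \<Longrightarrow> CN_density s z \<ge> 0"
  by (simp add: CN_density_def)

lemma borel_measurable_CN_density[measurable]: "CN_density s \<in> borel_measurable borel"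
  unfolding CN_density_def by measurable

text \<open>Real and imaginary part each carry half of the variance, hence the standard deviation
  \<open>sqrt (s / 2)\<close>. Complex integrals then factor into real normal ones.\<close>

lemma CN_density_eq_prod:
  assumes "s > 0"
  shows "CN_density s z = (\<Prod>b\<in>Basis. normal_density 0 (sqrt (s / 2)) (z \<bullet> b))"
proof -
  have "sqrt (pi * s) * sqrt (pi * s) = pi * s"
    using assms by simp
  then show ?thesis
    using assms
    by (simp add: CN_density_def normal_density_def Basis_complex_def cmod_power2 power2_i
        inner_complex_def field_simps flip: exp_add)
qed

lemma sets_CN0[measurable_cong, simp]: "sets (CN0 s) = sets borel"
  by (simp add: CN0_def)

lemma space_CN0[simp]: "space (CN0 s) = UNIV"
  by (simp add: CN0_def)

lemma nn_integral_normal_second_moment: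
  assumes "\<sigma> > 0"
  shows "(\<integral>\<^sup>+x. ennreal (x\<^sup>2 * normal_density 0 \<sigma> x) \<partial>lborel) = ennreal (\<sigma>\<^sup>2)"
  using integral_normal_moment_even[OF assms, of 0 1] integrable_normal_moment[OF assms, of 0 2]
  by (subst nn_integral_eq_integral) (auto simp: mult.commute)

lemma nn_integral_CN_density:
  assumes "s > 0"
  shows "(\<integral>\<^sup>+z. ennreal (CN_density s z) \<partial>lborel) = 1"
proof -
  have [simp]: "(\<integral>\<^sup>+x. ennreal (normal_density 0 (sqrt (s / 2)) x) \<partial>lborel) = 1"
    using assms by (subst nn_integral_eq_integral) auto
  have "(\<integral>\<^sup>+z. ennreal (CN_density s z) \<partial>lborel) =
     (\<integral>\<^sup>+z. (\<Prod>b\<in>Basis. ennreal (normal_density 0 (sqrt (s / 2)) (z \<bullet> b))) \<partial>(lborel::complex measure))"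
    using assms by (simp add: CN_density_eq_prod prod_ennreal)
  also have "\<dots> = 1"
    by (subst nn_integral_lborel_prod) auto
  finally show ?thesis .
qed

lemma nn_integral_CN_density_second_moment:
  assumes "s > 0"
  shows "(\<integral>\<^sup>+z. ennreal (CN_density s z * (cmod z)\<^sup>2) \<partial>lborel) = ennreal s"
proof -
  let ?n = "normal_density 0 (sqrt (s / 2))"
  \<comment> \<open>\<open>?f c\<close> puts the square on coordinate \<open>c\<close> alone, so
    that the squared modulus splits into two integrands of product form.\<close>
  let ?f = "\<lambda>c b x. if b = c then ennreal (x\<^sup>2 * ?n x) else ennreal (?n x)"
  have [simp]: "(\<integral>\<^sup>+x. ennreal (?n x) \<partial>lborel) = 1"
    using assms by (subst nn_integral_eq_integral) auto
  have [simp]: "(\<integral>\<^sup>+x. ennreal (x\<^sup>2 * ?n x) \<partial>lborel) = ennreal (s / 2)"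
    using assms by (subst nn_integral_normal_second_moment) auto
  have coord: "(\<integral>\<^sup>+z. (\<Prod>b\<in>Basis. ?f c b (z \<bullet> b)) \<partial>(lborel::complex measure)) = ennreal (s / 2)"
    if "c \<in> Basis" for c
    by (subst nn_integral_lborel_prod) (use that in \<open>auto simp: Basis_complex_def\<close>)
  have "(\<integral>\<^sup>+z. ennreal (CN_density s z * (cmod z)\<^sup>2) \<partial>lborel) =
     (\<integral>\<^sup>+z. (\<Prod>b\<in>Basis. ?f 1 b (z \<bullet> b)) + (\<Prod>b\<in>Basis. ?f \<i> b (z \<bullet> b)) \<partial>lborel)"
    using assms
    by (intro nn_integral_cong)
       (simp add: CN_density_eq_prod Basis_complex_def cmod_power2 inner_complex_def
         algebra_simps flip: ennreal_mult' ennreal_plus)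
  also have "\<dots> = ennreal (s / 2) + ennreal (s / 2)"
    using coord[of 1] coord[of \<i>]
    by (subst nn_integral_add) (simp_all add: Basis_complex_def)
  finally show ?thesis
    using assms by (simp flip: ennreal_plus)
qed

section \<open>Translation, convolution and scaling of circular Gaussians\<close>

lemma nn_integral_lborel_shift:
  fixes f :: "'a::euclidean_space \<Rightarrow> ennreal"
  assumes [measurable]: "f \<in> borel_measurable borel"
  shows "(\<integral>\<^sup>+x. f (a + x) \<partial>lborel) = (\<integral>\<^sup>+x. f x \<partial>lborel)"
proof -
  have "(\<integral>\<^sup>+x. f x \<partial>lborel) = (\<integral>\<^sup>+x. f x \<partial>distr lborel borel ((+) a))"
    by (simp add: lborel_distr_plus)
  then show ?thesis
    by (simp add: nn_integral_distr)
qed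

lemma nn_integral_CN0:
  assumes "f \<in> borel_measurable borel"
  shows "(\<integral>\<^sup>+z. f z \<partial>CN0 s) = (\<integral>\<^sup>+z. ennreal (CN_density s z) * f z \<partial>lborel)"
  unfolding CN0_def CN_density_def[symmetric]
  using assms by (subst nn_integral_density) auto

lemma prob_space_CN0:
  assumes "s > 0"
  shows "prob_space (CN0 s)"
  by (rule prob_spaceI)
     (use assms nn_integral_CN0[of "\<lambda>_. 1" s] nn_integral_CN_density in \<open>simp add: CN0_def\<close>)

text \<open>Completing the square in \<open>y\<close>. In probabilistic terms, the joint density of
  a sum \<open>x\<close> and its second summand \<open>y\<close> is the density of the sum times the
  conditional density of the summand, which has mean \<open>t / (s + t) * x\<close> and variance
  \<open>s * t / (s + t)\<close>.\<close>

lemma CN_density_convolution_point: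
  assumes "s > 0" "t > 0"
  shows "CN_density s (x - y) * CN_density t y =
    CN_density (s + t) x * CN_density (s * t / (s + t)) (- of_real (t / (s + t)) * x + y)"
proof -
  have eq: "(cmod (x - y))\<^sup>2 / s + (cmod y)\<^sup>2 / t = (cmod x)\<^sup>2 / (s + t) +
    (cmod (- of_real (t / (s + t)) * x + y))\<^sup>2 / (s * t / (s + t))"
  proof -
    obtain a b c d where [simp]: "x = Complex a b" "y = Complex c d"
      by (metis complex.exhaust)
    \<comment> \<open>The identity is proved for reals and then applied to the real and the
      imaginary parts.\<close>
    have "(a - c)\<^sup>2 / s + c\<^sup>2 / t = a\<^sup>2 / (s + t) + (c - t / (s + t) * a)\<^sup>2 / (s * t / (s + t))" for a c
      using assms by (auto simp: divide_simps power2_eq_square) (algebra | simp add: algebra_simps)+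
    from this[of a c] this[of b d]
    have "((a - c)\<^sup>2 + (b - d)\<^sup>2) / s + (c\<^sup>2 + d\<^sup>2) / t = (a\<^sup>2 + b\<^sup>2) / (s + t) +
        ((c - t / (s + t) * a)\<^sup>2 + (d - t / (s + t) * b)\<^sup>2) / (s * t / (s + t))"
      by (simp only: add_divide_distrib)
    moreover have "- complex_of_real (t / (s + t)) * x + y = Complex (c - t / (s + t) * a) (d - t / (s + t) * b)"
      by (simp add: complex_eq_iff)
    ultimately show ?thesis
      by (simp add: cmod_power2)
  qed
  have prod: "CN_density a z * CN_density b w = exp (- ((cmod z)\<^sup>2 / a + (cmod w)\<^sup>2 / b)) / (pi\<^sup>2 * (a * b))" for a b z w
    by (simp add: CN_density_def power2_eq_square exp_add[symmetric])
  have "(s + t) * (s * t / (s + t)) = s * t"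
    using assms by simp
  then show ?thesis
    unfolding prod eq by simp
qed

lemma nn_integral_CN_density_convolution:
  assumes "s > 0" "t > 0"
  shows "(\<integral>\<^sup>+y. ennreal (CN_density s (x - y)) * ennreal (CN_density t y) \<partial>lborel) = ennreal (CN_density (s + t) x)"
proof -
  have "(\<integral>\<^sup>+y. ennreal (CN_density s (x - y)) * ennreal (CN_density t y) \<partial>lborel) =
    (\<integral>\<^sup>+y. ennreal (CN_density (s + t) x) *
       ennreal (CN_density (s * t / (s + t)) (- of_real (t / (s + t)) * x + y)) \<partial>lborel)"
    using assms by (simp add: CN_density_convolution_point CN_density_nonneg flip: ennreal_mult)
  also have "\<dots> = ennreal (CN_density (s + t) x) * (\<integral>\<^sup>+y. ennreal (CN_density (s * t / (s + t)) y) \<partial>lborel)"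
  proof (subst nn_integral_cmult)
    show "ennreal (CN_density (s + t) x) * (\<integral>\<^sup>+y. ennreal (CN_density (s * t / (s + t)) (- of_real (t / (s + t)) * x + y)) \<partial>lborel) =
        ennreal (CN_density (s + t) x) * (\<integral>\<^sup>+y. ennreal (CN_density (s * t / (s + t)) y) \<partial>lborel)"
      by (subst nn_integral_lborel_shift) simp_all
  qed measurable
  finally show ?thesis
    using assms by (simp add: nn_integral_CN_density)
qed

lemma nn_integral_CN0_shift:
  assumes [measurable]: "f \<in> borel_measurable borel"
  shows "(\<integral>\<^sup>+w. f (x + w) \<partial>CN0 s) = (\<integral>\<^sup>+y. ennreal (CN_density s (y - x)) * f y \<partial>lborel)"
  using nn_integral_lborel_shift[of "\<lambda>y. ennreal (CN_density s (y - x)) * f y" x]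
  by (simp add: nn_integral_CN0)

text \<open>After exchanging the order of integration, the inner integral is the convolution of the
  two densities.\<close>

lemma nn_integral_CN0_add:
  assumes "s > 0" "t > 0" and [measurable]: "f \<in> borel_measurable borel"
  shows "(\<integral>\<^sup>+x. \<integral>\<^sup>+w. f (x + w) \<partial>CN0 s \<partial>CN0 t) = (\<integral>\<^sup>+y. f y \<partial>CN0 (s + t))"
proof -
  have "(\<integral>\<^sup>+x. \<integral>\<^sup>+w. f (x + w) \<partial>CN0 s \<partial>CN0 t) =
    (\<integral>\<^sup>+x. ennreal (CN_density t x) * (\<integral>\<^sup>+y. ennreal (CN_density s (y - x)) * f y \<partial>lborel) \<partial>lborel)"
    by (simp add: nn_integral_CN0_shift, subst nn_integral_CN0) simp_all
  also have "\<dots> = (\<integral>\<^sup>+x. \<integral>\<^sup>+y. ennreal (CN_density t x) * (ennreal (CN_density s (y - x)) * f y) \<partial>lborel \<partial>lborel)"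
    by (simp add: nn_integral_cmult)
  also have "\<dots> = (\<integral>\<^sup>+y. \<integral>\<^sup>+x. ennreal (CN_density t x) * (ennreal (CN_density s (y - x)) * f y) \<partial>lborel \<partial>lborel)"
    by (rule lborel_pair.Fubini') measurable
  also have "\<dots> = (\<integral>\<^sup>+y. (\<integral>\<^sup>+x. ennreal (CN_density s (y - x)) * ennreal (CN_density t x) \<partial>lborel) * f y \<partial>lborel)"
    by (subst nn_integral_multc[symmetric]) (simp_all add: ac_simps)
  finally show ?thesis
    using assms by (simp add: nn_integral_CN_density_convolution nn_integral_CN0)
qed

lemma nn_integral_CN0_scale:
  assumes "s > 0" "c \<noteq> 0" and [measurable]: "f \<in> borel_measurable borel"
  shows "(\<integral>\<^sup>+x. f (of_real c * x) \<partial>CN0 s) = (\<integral>\<^sup>+y. f y \<partial>CN0 (c\<^sup>2 * s))"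
proof -
  have "(lborel :: complex measure) = density (distr lborel borel (\<lambda>x. 0 + c *\<^sub>R x)) (\<lambda>_. \<bar>c\<bar> ^ DIM(complex))"
    using lborel_affine[OF assms(2), of "0::complex"] by simp
  then have "(\<integral>\<^sup>+y. ennreal (CN_density (c\<^sup>2 * s) y) * f y \<partial>lborel) =
    (\<integral>\<^sup>+y. ennreal (CN_density (c\<^sup>2 * s) y) * f y
       \<partial>density (distr lborel borel (\<lambda>x. 0 + c *\<^sub>R x)) (\<lambda>_. \<bar>c\<bar> ^ DIM(complex)))"
    by simp
  also have "\<dots> = (\<integral>\<^sup>+x. ennreal (c\<^sup>2) * (ennreal (CN_density (c\<^sup>2 * s) (c *\<^sub>R x)) * f (c *\<^sub>R x)) \<partial>lborel)"
    by (subst nn_integral_density) (simp_all add: nn_integral_distr)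
  also have "\<dots> = (\<integral>\<^sup>+x. ennreal (CN_density s x) * f (of_real c * x) \<partial>lborel)"
  proof (intro nn_integral_cong)
    fix x
    \<comment> \<open>The Jacobian of a dilation of the plane is \<open>c\<^sup>2\<close> and
      cancels against the normalising constant of the density.\<close>
    have "c\<^sup>2 * CN_density (c\<^sup>2 * s) (c *\<^sub>R x) = CN_density s x"
      using assms by (simp add: CN_density_def power_mult_distrib)
    moreover have "CN_density (c\<^sup>2 * s) (c *\<^sub>R x) \<ge> 0"
      using assms by (simp add: CN_density_nonneg)
    ultimately show "ennreal (c\<^sup>2) * (ennreal (CN_density (c\<^sup>2 * s) (c *\<^sub>R x)) * f (c *\<^sub>R x)) =
        ennreal (CN_density s x) * f (of_real c * x)"
      by (simp add: mult.assoc[symmetric] scaleR_conv_of_real flip: ennreal_mult')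
  qed
  finally show ?thesis
    by (simp add: nn_integral_CN0)
qed

text \<open>The sum is written as a rescaled standard Gaussian because \<open>CN0 0\<close> is a junk value, while the
  total variance is \<open>0\<close> when all coefficients vanish.\<close>
lemma nn_integral_PiM_CN0_sum:
  fixes c :: "'i \<Rightarrow> real"
  assumes "s > 0" "finite J" and [measurable]: "f \<in> borel_measurable borel"
  shows "(\<integral>\<^sup>+b. f (w + (\<Sum>j\<in>J. of_real (c j) * b j)) \<partial>PiM J (\<lambda>_. CN0 s)) =
    (\<integral>\<^sup>+z. f (w + of_real (sqrt ((\<Sum>j\<in>J. (c j)\<^sup>2) * s)) * z) \<partial>CN0 1)"
  using assms(2)
proof (induction J arbitrary: w)
  case empty
  interpret prob_space "CN0 1" by (rule prob_space_CN0) simp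
  show ?case
    by (simp add: PiM_empty nn_integral_count_space_finite emeasure_space_1 flip: space_CN0)
next
  case (insert i I)
  interpret CN: prob_space "CN0 s" by (rule prob_space_CN0) fact
  interpret CN1: prob_space "CN0 1" by (rule prob_space_CN0) simp
  interpret product_sigma_finite "\<lambda>_::'i. CN0 s" ..
  let ?V = "(\<Sum>j\<in>I. (c j)\<^sup>2) * s"
  have V: "?V \<ge> 0" using assms(1) by (simp add: sum_nonneg)
  \<comment> \<open>At positive variance the rescaled standard Gaussian is \<open>CN0 v\<close>
    itself. The cases \<open>c i = 0\<close> and \<open>?V = 0\<close>, where this or the scaling
    rule fails, are split off below.\<close>
  have sq: "(\<integral>\<^sup>+z. g (of_real (sqrt v) * z) \<partial>CN0 1) = (\<integral>\<^sup>+z. g z \<partial>CN0 v)"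
    if "v > 0" "g \<in> borel_measurable borel" for v and g :: "complex \<Rightarrow> ennreal"
    using nn_integral_CN0_scale[of 1 "sqrt v" g] that by simp
  have "(\<integral>\<^sup>+b. f (w + (\<Sum>j\<in>insert i I. of_real (c j) * b j)) \<partial>PiM (insert i I) (\<lambda>_. CN0 s)) =
    (\<integral>\<^sup>+x. \<integral>\<^sup>+b. f (w + (\<Sum>j\<in>insert i I. of_real (c j) * (b(i := x)) j)) \<partial>PiM I (\<lambda>_. CN0 s) \<partial>CN0 s)"
    using insert.hyps by (subst product_nn_integral_insert_rev) auto
  also have "\<dots> = (\<integral>\<^sup>+x. \<integral>\<^sup>+b. f ((w + of_real (c i) * x) + (\<Sum>j\<in>I. of_real (c j) * b j)) \<partial>PiM I (\<lambda>_. CN0 s) \<partial>CN0 s)"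
  proof (intro nn_integral_cong arg_cong[where f = f])
    fix x and b :: "'i \<Rightarrow> complex"
    have "(\<Sum>j\<in>I. complex_of_real (c j) * (b(i := x)) j) = (\<Sum>j\<in>I. of_real (c j) * b j)"
      using insert.hyps by (intro sum.cong) auto
    then show "w + (\<Sum>j\<in>insert i I. of_real (c j) * (b(i := x)) j) =
       (w + of_real (c i) * x) + (\<Sum>j\<in>I. of_real (c j) * b j)"
      using insert.hyps by (simp add: add.assoc)
  qed
  also have "\<dots> = (\<integral>\<^sup>+x. \<integral>\<^sup>+z. f (w + of_real (c i) * x + of_real (sqrt ?V) * z) \<partial>CN0 1 \<partial>CN0 s)"
    by (simp add: insert.IH)
  also have "\<dots> = (\<integral>\<^sup>+z. f (w + of_real (sqrt ((c i)\<^sup>2 * s + ?V)) * z) \<partial>CN0 1)"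
  proof (cases "c i = 0")
    case True
    then show ?thesis
      by (simp add: CN.emeasure_space_1[simplified])
  next
    case False
    then have ci: "(c i)\<^sup>2 * s > 0" using assms(1) by simp
    have "(\<integral>\<^sup>+x. \<integral>\<^sup>+z. f (w + of_real (c i) * x + of_real (sqrt ?V) * z) \<partial>CN0 1 \<partial>CN0 s) =
      (\<integral>\<^sup>+x. \<integral>\<^sup>+z. f (w + x + of_real (sqrt ?V) * z) \<partial>CN0 1 \<partial>CN0 ((c i)\<^sup>2 * s))"
      using nn_integral_CN0_scale[OF assms(1) False, of "\<lambda>x. \<integral>\<^sup>+z. f (w + x + of_real (sqrt ?V) * z) \<partial>CN0 1"]
      by simp
    also have "\<dots> = (\<integral>\<^sup>+z. f (w + z) \<partial>CN0 ((c i)\<^sup>2 * s + ?V))"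
    proof (cases "?V = 0")
      case True
      show ?thesis
        unfolding True by (simp add: CN1.emeasure_space_1[simplified])
    next
      case False
      then have "?V > 0" using V by linarith
      then show ?thesis
        using sq[of ?V "\<lambda>z. f (w + _ + z)"] nn_integral_CN0_add[of ?V "(c i)\<^sup>2 * s" "\<lambda>z. f (w + z)"] ci
        by (simp add: add.assoc add.commute[of "(c i)\<^sup>2 * s"])
    qed
    also have "\<dots> = (\<integral>\<^sup>+z. f (w + of_real (sqrt ((c i)\<^sup>2 * s + ?V)) * z) \<partial>CN0 1)"
      using sq[of "(c i)\<^sup>2 * s + ?V" "\<lambda>z. f (w + z)"] ci V by simp
    finally show ?thesis .
  qed
  finally show ?case
    using insert.hyps by (simp add: distrib_right)
qed

section \<open>Conditional mutual information of a Gaussian channel with finite random state\<close>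

text \<open>Densities are checked against all nonnegative test functions instead of sets, because
  the channel below is itself described by such integrals.\<close>

lemma distributedI_nn_integral:
  assumes [measurable]: "X \<in> measurable M N" "f \<in> borel_measurable N"
    and eq: "\<And>g. g \<in> borel_measurable N \<Longrightarrow> (\<integral>\<^sup>+\<omega>. g (X \<omega>) \<partial>M) = (\<integral>\<^sup>+x. f x * g x \<partial>N)"
  shows "distributed M N X f"
  unfolding distributed_def
proof (intro conjI measure_eqI)
  fix A assume "A \<in> sets (distr M N X)"
  then have A[measurable]: "A \<in> sets N" by simp
  have "emeasure (distr M N X) A = (\<integral>\<^sup>+x. indicator A x \<partial>distr M N X)"
    using A by simp
  also have "\<dots> = (\<integral>\<^sup>+\<omega>. indicator A (X \<omega>) \<partial>M)"
    by (rule nn_integral_distr) measurable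
  also have "\<dots> = emeasure (density N f) A"
    by (simp add: eq emeasure_density)
  finally show "emeasure (distr M N X) A = emeasure (density N f) A" .
qed (use assms in auto)

lemma borel_measurable_section_count_space:
  assumes "g \<in> borel_measurable (M \<Otimes>\<^sub>M count_space D)" "z \<in> D"
  shows "(\<lambda>y. g (y, z)) \<in> borel_measurable M"
  by (rule measurable_compose[OF _ assms(1)]) (use assms(2) in simp)

lemma borel_measurable_section_count_space2:
  assumes "g \<in> borel_measurable (M \<Otimes>\<^sub>M N \<Otimes>\<^sub>M count_space D)" "z \<in> D"
  shows "(\<lambda>u. g (fst u, snd u, z)) \<in> borel_measurable (M \<Otimes>\<^sub>M N)"
  by (rule measurable_compose[OF _ assms(1)]) (use assms(2) in simp)

lemma nn_integral_pair_count_space: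
  assumes "finite D" and M: "sigma_finite_measure M"
    and g[measurable]: "g \<in> borel_measurable (M \<Otimes>\<^sub>M count_space D)"
  shows "(\<integral>\<^sup>+u. g u \<partial>(M \<Otimes>\<^sub>M count_space D)) = (\<Sum>z\<in>D. \<integral>\<^sup>+y. g (y, z) \<partial>M)"
proof -
  interpret C: sigma_finite_measure "count_space D"
    by (rule sigma_finite_measure_count_space_finite) fact
  note [measurable] = borel_measurable_section_count_space[OF g]
  have "(\<integral>\<^sup>+u. g u \<partial>(M \<Otimes>\<^sub>M count_space D)) = (\<integral>\<^sup>+y. \<integral>\<^sup>+z. g (y, z) \<partial>count_space D \<partial>M)"
    by (rule C.nn_integral_fst[symmetric]) measurable
  also have "\<dots> = (\<Sum>z\<in>D. \<integral>\<^sup>+y. g (y, z) \<partial>M)"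
    using assms(1) by (simp add: nn_integral_count_space_finite nn_integral_sum)
  finally show ?thesis .
qed

text \<open>The order of integration on the right, with \<open>x\<close> outside and
  \<open>y\<close> inside, is the one in which a channel produces its input and then its
  output.\<close>

lemma nn_integral_triple_count_space:
  assumes "finite D" and M: "sigma_finite_measure M" and N: "sigma_finite_measure N"
    and g[measurable]: "g \<in> borel_measurable (M \<Otimes>\<^sub>M N \<Otimes>\<^sub>M count_space D)"
  shows "(\<integral>\<^sup>+u. g u \<partial>(M \<Otimes>\<^sub>M N \<Otimes>\<^sub>M count_space D)) =
    (\<Sum>z\<in>D. \<integral>\<^sup>+x. \<integral>\<^sup>+y. g (y, x, z) \<partial>M \<partial>N)"
proof -
  interpret N: sigma_finite_measure N by fact
  interpret M: sigma_finite_measure M by fact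
  interpret MN: pair_sigma_finite M N ..
  interpret C: sigma_finite_measure "count_space D"
    by (rule sigma_finite_measure_count_space_finite) fact
  interpret NC: pair_sigma_finite N "count_space D" ..
  note sec[measurable] = borel_measurable_section_count_space2[OF g]
  have [measurable]: "(\<lambda>y. \<integral>\<^sup>+x. g (y, x, z) \<partial>N) \<in> borel_measurable M" if "z \<in> D" for z
    using N.borel_measurable_nn_integral[of "\<lambda>y x. g (y, x, z)" M] that by (simp add: split_beta')
  have "(\<integral>\<^sup>+u. g u \<partial>(M \<Otimes>\<^sub>M N \<Otimes>\<^sub>M count_space D)) = (\<integral>\<^sup>+y. \<integral>\<^sup>+u. g (y, u) \<partial>(N \<Otimes>\<^sub>M count_space D) \<partial>M)"
    by (rule NC.nn_integral_fst[symmetric]) measurable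
  also have "\<dots> = (\<integral>\<^sup>+y. (\<Sum>z\<in>D. \<integral>\<^sup>+x. g (y, x, z) \<partial>N) \<partial>M)"
    by (intro nn_integral_cong, subst nn_integral_pair_count_space) (auto intro: assms)
  also have "\<dots> = (\<Sum>z\<in>D. \<integral>\<^sup>+y. \<integral>\<^sup>+x. g (y, x, z) \<partial>N \<partial>M)"
    by (simp add: nn_integral_sum)
  also have "\<dots> = (\<Sum>z\<in>D. \<integral>\<^sup>+x. \<integral>\<^sup>+y. g (y, x, z) \<partial>M \<partial>N)"
    by (intro sum.cong refl MN.Fubini'[symmetric]) (simp add: split_beta')
  finally show ?thesis .
qed

lemma ln_CN_density: "s > 0 \<Longrightarrow> ln (CN_density s z) = - (cmod z)\<^sup>2 / s - ln (pi * s)"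
  by (simp add: CN_density_def ln_div)

lemma emeasure_CN0_UNIV[simp]: "s > 0 \<Longrightarrow> emeasure (CN0 s) UNIV = 1"
  using prob_space.emeasure_space_1[OF prob_space_CN0] by simp

text \<open>A channel with random state: given \<open>Z = z\<close>, which has probability
  \<open>p z\<close>, the output \<open>Y\<close> is the input \<open>X\<close> plus independent
  circular noise of variance \<open>v z\<close>. Stating \<open>joint\<close> for arbitrary test
  functions makes every marginal law an instance of one identity.\<close>

locale gaussian_mixture = information_space +
  fixes X Y :: "'a \<Rightarrow> complex" and Z :: "'a \<Rightarrow> 'z" and p v :: "'z \<Rightarrow> real"
    and D :: "'z set" and E :: real
  assumes D: "finite D" and E: "E > 0"
    and p: "\<And>z. z \<in> D \<Longrightarrow> p z > 0" and v: "\<And>z. z \<in> D \<Longrightarrow> v z > 0"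
    and X[measurable]: "X \<in> borel_measurable M" and Y[measurable]: "Y \<in> borel_measurable M"
    and Z[measurable]: "Z \<in> measurable M (count_space D)"
    and joint: "\<And>g. g \<in> borel_measurable (borel \<Otimes>\<^sub>M borel \<Otimes>\<^sub>M count_space D) \<Longrightarrow>
      (\<integral>\<^sup>+\<omega>. g (Y \<omega>, X \<omega>, Z \<omega>) \<partial>M) =
        (\<Sum>z\<in>D. ennreal (p z) * (\<integral>\<^sup>+x. \<integral>\<^sup>+w. g (x + w, x, z) \<partial>CN0 (v z) \<partial>CN0 E))"
begin

lemma p_v_nonneg[simp]:
  assumes "z \<in> D"
  shows "p z \<ge> 0" "v z \<ge> 0" "v z + E > 0" "v z + E \<ge> 0"
  using p[OF assms] v[OF assms] E by auto

lemma Z_in_D: "\<omega> \<in> space M \<Longrightarrow> Z \<omega> \<in> D"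
  using measurable_space[OF Z] by simp

lemma sum_p: "(\<Sum>z\<in>D. p z) = 1"
proof -
  have "ennreal (\<Sum>z\<in>D. p z) = 1"
    using joint[of "\<lambda>_. 1"] v E by (simp add: emeasure_space_1 sum_ennreal)
  then show ?thesis by simp
qed

text \<open>All densities are taken with respect to Lebesgue measure in the complex coordinates and
  counting measure in the state. Only \<open>density_y\<close> is a genuine mixture, so its
  logarithm is the only one without an explicit form.\<close>

definition "density_xz = (\<lambda>(x, z). p z * CN_density E x)"
definition "density_yz = (\<lambda>(y, z). p z * CN_density (v z + E) y)"
definition "density_y = (\<lambda>y. \<Sum>z\<in>D. p z * CN_density (v z + E) y)"
definition "density_yxz = (\<lambda>(y, x, z). p z * CN_density E x * CN_density (v z) (y - x))"

lemma measurable_densities[measurable]: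
  "density_xz \<in> borel_measurable (borel \<Otimes>\<^sub>M count_space D)"
  "density_yz \<in> borel_measurable (borel \<Otimes>\<^sub>M count_space D)"
  "density_y \<in> borel_measurable borel"
  "density_yxz \<in> borel_measurable (borel \<Otimes>\<^sub>M borel \<Otimes>\<^sub>M count_space D)"
proof -
  have [measurable]: "p \<in> borel_measurable (count_space D)" "v \<in> borel_measurable (count_space D)"
    by simp_all
  show "density_xz \<in> borel_measurable (borel \<Otimes>\<^sub>M count_space D)"
    "density_yz \<in> borel_measurable (borel \<Otimes>\<^sub>M count_space D)"
    "density_y \<in> borel_measurable borel"
    "density_yxz \<in> borel_measurable (borel \<Otimes>\<^sub>M borel \<Otimes>\<^sub>M count_space D)"
    unfolding density_xz_def density_yz_def density_y_def density_yxz_def CN_density_def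
    by measurable
qed

text \<open>With the input integrated out, input and noise merge into one Gaussian whose variance is
  the sum. The laws of \<open>(Y, Z)\<close> and of \<open>Y\<close> and the second moment of
  \<open>Y\<close> all follow from this.\<close>

lemma nn_integral_YZ:
  assumes [measurable]: "g \<in> borel_measurable (borel \<Otimes>\<^sub>M count_space D)"
  shows "(\<integral>\<^sup>+\<omega>. g (Y \<omega>, Z \<omega>) \<partial>M) =
      (\<Sum>z\<in>D. ennreal (p z) * (\<integral>\<^sup>+y. ennreal (CN_density (v z + E) y) * g (y, z) \<partial>lborel))"
proof -
  have [measurable]: "(\<lambda>y. g (y, z)) \<in> borel_measurable borel" if "z \<in> D" for z
    using borel_measurable_section_count_space[of g lborel D z] that by simp
  have "(\<integral>\<^sup>+\<omega>. g (Y \<omega>, Z \<omega>) \<partial>M) =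
      (\<Sum>z\<in>D. ennreal (p z) * (\<integral>\<^sup>+x. \<integral>\<^sup>+w. g (x + w, z) \<partial>CN0 (v z) \<partial>CN0 E))"
    using joint[of "\<lambda>(y, x, z). g (y, z)"] by simp
  also have "\<dots> = (\<Sum>z\<in>D. ennreal (p z) * (\<integral>\<^sup>+y. ennreal (CN_density (v z + E) y) * g (y, z) \<partial>lborel))"
  proof (intro sum.cong refl arg_cong[where f = "(*) _"])
    fix z assume z: "z \<in> D"
    show "(\<integral>\<^sup>+x. \<integral>\<^sup>+w. g (x + w, z) \<partial>CN0 (v z) \<partial>CN0 E) =
        (\<integral>\<^sup>+y. ennreal (CN_density (v z + E) y) * g (y, z) \<partial>lborel)"
      using z nn_integral_CN0_add[of "v z" E "\<lambda>y. g (y, z)"] v[OF z] E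
      by (simp add: nn_integral_CN0)
  qed
  finally show ?thesis .
qed

lemma distributed_Z: "distributed M (count_space D) Z p"
proof (rule distributedI_nn_integral)
  fix g :: "'z \<Rightarrow> ennreal"
  have "(\<lambda>(y, x, z). g z) \<in> borel_measurable ((borel :: complex measure) \<Otimes>\<^sub>M (borel :: complex measure) \<Otimes>\<^sub>M count_space D)"
    unfolding split_beta' by (rule measurable_compose[of _ _ "count_space D"]) auto
  then show "(\<integral>\<^sup>+\<omega>. g (Z \<omega>) \<partial>M) = (\<integral>\<^sup>+z. ennreal (p z) * g z \<partial>count_space D)"
    using joint[of "\<lambda>(y, x, z). g z"] v E D
    by (simp add: nn_integral_count_space_finite )
qed measurable

lemma distributed_XZ: "distributed M (lborel \<Otimes>\<^sub>M count_space D) (\<lambda>\<omega>. (X \<omega>, Z \<omega>)) density_xz"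
proof (rule distributedI_nn_integral)
  fix g :: "complex \<times> 'z \<Rightarrow> ennreal" assume g[measurable]: "g \<in> borel_measurable (lborel \<Otimes>\<^sub>M count_space D)"
  have [measurable]: "(\<lambda>y. g (y, z)) \<in> borel_measurable borel" if "z \<in> D" for z
    using borel_measurable_section_count_space[of g lborel D z] that by simp
  have "(\<integral>\<^sup>+\<omega>. g (X \<omega>, Z \<omega>) \<partial>M) =
      (\<Sum>z\<in>D. ennreal (p z) * (\<integral>\<^sup>+x. ennreal (CN_density E x) * g (x, z) \<partial>lborel))"
    using joint[of "\<lambda>(y, x, z). g (x, z)"] v by (simp add: nn_integral_CN0)
  also have "\<dots> = (\<integral>\<^sup>+u. ennreal (density_xz u) * g u \<partial>(lborel \<Otimes>\<^sub>M count_space D))"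
    by (subst nn_integral_pair_count_space[OF D sigma_finite_lborel], measurable)
      (simp add: density_xz_def ennreal_mult' mult.assoc nn_integral_cmult)
  finally show "(\<integral>\<^sup>+\<omega>. g (X \<omega>, Z \<omega>) \<partial>M) = (\<integral>\<^sup>+u. ennreal (density_xz u) * g u \<partial>(lborel \<Otimes>\<^sub>M count_space D))" .
qed measurable

lemma distributed_YZ: "distributed M (lborel \<Otimes>\<^sub>M count_space D) (\<lambda>\<omega>. (Y \<omega>, Z \<omega>)) density_yz"
proof (rule distributedI_nn_integral)
  fix g :: "complex \<times> 'z \<Rightarrow> ennreal" assume g[measurable]: "g \<in> borel_measurable (lborel \<Otimes>\<^sub>M count_space D)"
  have [measurable]: "(\<lambda>y. g (y, z)) \<in> borel_measurable borel" if "z \<in> D" for z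
    using borel_measurable_section_count_space[of g lborel D z] that by simp
  have "(\<integral>\<^sup>+\<omega>. g (Y \<omega>, Z \<omega>) \<partial>M) =
      (\<Sum>z\<in>D. ennreal (p z) * (\<integral>\<^sup>+y. ennreal (CN_density (v z + E) y) * g (y, z) \<partial>lborel))"
    by (rule nn_integral_YZ) measurable
  also have "\<dots> = (\<integral>\<^sup>+u. ennreal (density_yz u) * g u \<partial>(lborel \<Otimes>\<^sub>M count_space D))"
    by (subst nn_integral_pair_count_space[OF D sigma_finite_lborel], measurable)
      (simp add: density_yz_def ennreal_mult' mult.assoc nn_integral_cmult)
  finally show "(\<integral>\<^sup>+\<omega>. g (Y \<omega>, Z \<omega>) \<partial>M) = (\<integral>\<^sup>+u. ennreal (density_yz u) * g u \<partial>(lborel \<Otimes>\<^sub>M count_space D))" .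
qed measurable

lemma distributed_Y: "distributed M lborel Y density_y"
proof (rule distributedI_nn_integral)
  fix g :: "complex \<Rightarrow> ennreal" assume g[measurable]: "g \<in> borel_measurable lborel"
  have "(\<integral>\<^sup>+\<omega>. g (Y \<omega>) \<partial>M) =
      (\<Sum>z\<in>D. ennreal (p z) * (\<integral>\<^sup>+y. ennreal (CN_density (v z + E) y) * g y \<partial>lborel))"
    using nn_integral_YZ[of "\<lambda>(y, z). g y"] by simp
  also have "\<dots> = (\<integral>\<^sup>+y. (\<Sum>z\<in>D. ennreal (p z) * (ennreal (CN_density (v z + E) y) * g y)) \<partial>lborel)"
    by (subst nn_integral_sum) (simp_all add: nn_integral_cmult)
  also have "\<dots> = (\<integral>\<^sup>+y. ennreal (density_y y) * g y \<partial>lborel)"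
    by (intro nn_integral_cong)
      (simp add: density_y_def sum_distrib_right[symmetric] sum_ennreal[symmetric] CN_density_nonneg
        ennreal_mult' mult.assoc[symmetric])
  finally show "(\<integral>\<^sup>+\<omega>. g (Y \<omega>) \<partial>M) = (\<integral>\<^sup>+y. ennreal (density_y y) * g y \<partial>lborel)" .
qed measurable

lemma distributed_YXZ: "distributed M (lborel \<Otimes>\<^sub>M lborel \<Otimes>\<^sub>M count_space D) (\<lambda>\<omega>. (Y \<omega>, X \<omega>, Z \<omega>)) density_yxz"
proof (rule distributedI_nn_integral)
  fix g :: "complex \<times> complex \<times> 'z \<Rightarrow> ennreal"
  assume g[measurable]: "g \<in> borel_measurable (lborel \<Otimes>\<^sub>M lborel \<Otimes>\<^sub>M count_space D)"
  have [measurable]: "(\<lambda>u. g (fst u, snd u, z)) \<in> borel_measurable (borel \<Otimes>\<^sub>M borel)" if "z \<in> D" for z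
    using borel_measurable_section_count_space2[of g borel borel D z] that by simp
  have [measurable]: "(\<lambda>y. g (y, x, z)) \<in> borel_measurable borel" if "z \<in> D" for x z
    using measurable_compose[OF measurable_Pair2'[of x borel borel]
        borel_measurable_section_count_space2[of g borel borel D z]] that by simp
  have [measurable]: "(\<lambda>x. \<integral>\<^sup>+y. ennreal (CN_density (v z) (y - x)) * g (y, x, z) \<partial>lborel) \<in> borel_measurable borel"
    if "z \<in> D" for z
    using sigma_finite_measure.borel_measurable_nn_integral[OF sigma_finite_lborel,
        of "\<lambda>x y. ennreal (CN_density (v z) (y - x)) * g (y, x, z)" borel] that
    by (simp add: split_beta')
  have "(\<integral>\<^sup>+\<omega>. g (Y \<omega>, X \<omega>, Z \<omega>) \<partial>M) =
      (\<Sum>z\<in>D. ennreal (p z) * (\<integral>\<^sup>+x. \<integral>\<^sup>+w. g (x + w, x, z) \<partial>CN0 (v z) \<partial>CN0 E))"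
    by (rule joint) measurable
  also have "\<dots> = (\<Sum>z\<in>D. ennreal (p z) * (\<integral>\<^sup>+x. ennreal (CN_density E x) *
     (\<integral>\<^sup>+y. ennreal (CN_density (v z) (y - x)) * g (y, x, z) \<partial>lborel) \<partial>lborel))"
  proof (intro sum.cong refl arg_cong[where f = "(*) _"])
    fix z assume z: "z \<in> D"
    have "(\<integral>\<^sup>+w. g (x + w, x, z) \<partial>CN0 (v z)) =
        (\<integral>\<^sup>+y. ennreal (CN_density (v z) (y - x)) * g (y, x, z) \<partial>lborel)" for x
      using nn_integral_CN0_shift[of "\<lambda>y. g (y, x, z)" "v z" x] z by simp
    then show "(\<integral>\<^sup>+x. \<integral>\<^sup>+w. g (x + w, x, z) \<partial>CN0 (v z) \<partial>CN0 E) = (\<integral>\<^sup>+x. ennreal (CN_density E x) *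
        (\<integral>\<^sup>+y. ennreal (CN_density (v z) (y - x)) * g (y, x, z) \<partial>lborel) \<partial>lborel)"
      using z by (simp add: nn_integral_CN0)
  qed
  also have "\<dots> = (\<integral>\<^sup>+u. ennreal (density_yxz u) * g u \<partial>(lborel \<Otimes>\<^sub>M lborel \<Otimes>\<^sub>M count_space D))"
    by (subst nn_integral_triple_count_space[OF D sigma_finite_lborel sigma_finite_lborel], measurable)
      (simp add: density_yxz_def ennreal_mult' CN_density_nonneg E mult.assoc nn_integral_cmult)
  finally show "(\<integral>\<^sup>+\<omega>. g (Y \<omega>, X \<omega>, Z \<omega>) \<partial>M) =
    (\<integral>\<^sup>+u. ennreal (density_yxz u) * g u \<partial>(lborel \<Otimes>\<^sub>M lborel \<Otimes>\<^sub>M count_space D))" .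
qed measurable

section \<open>Second moments and integrability of the log-densities\<close>

lemma integrable_Z: "integrable M (\<lambda>\<omega>. h (Z \<omega>))" for h :: "'z \<Rightarrow> real"
proof (rule integrable_const_bound[of _ "\<Sum>z\<in>D. \<bar>h z\<bar>"])
  show "AE \<omega> in M. norm (h (Z \<omega>)) \<le> (\<Sum>z\<in>D. \<bar>h z\<bar>)"
  proof (rule AE_I2)
    fix \<omega> assume "\<omega> \<in> space M"
    then show "norm (h (Z \<omega>)) \<le> (\<Sum>z\<in>D. \<bar>h z\<bar>)"
      using member_le_sum[of "Z \<omega>" D "\<lambda>z. \<bar>h z\<bar>"] D Z_in_D by simp
  qed
qed (rule measurable_compose[OF Z], simp)

text \<open>Normalised by its conditional variance, the output has second moment 1 in every state.
  The same holds for the noise, and this is why the two quadratic terms cancel in the mutual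
  information.\<close>

lemma nn_integral_Y_second_moment:
  "(\<integral>\<^sup>+\<omega>. ennreal ((cmod (Y \<omega>))\<^sup>2 / (v (Z \<omega>) + E)) \<partial>M) = 1"
proof -
  have [measurable]: "v \<in> borel_measurable (count_space D)" by simp
  have "(\<integral>\<^sup>+\<omega>. ennreal ((cmod (Y \<omega>))\<^sup>2 / (v (Z \<omega>) + E)) \<partial>M) =
     (\<Sum>z\<in>D. ennreal (p z) * (\<integral>\<^sup>+y. ennreal (CN_density (v z + E) y) * ennreal ((cmod y)\<^sup>2 / (v z + E)) \<partial>lborel))"
    using nn_integral_YZ[of "\<lambda>(y, z). ennreal ((cmod y)\<^sup>2 / (v z + E))"] by simp
  also have "\<dots> = (\<Sum>z\<in>D. ennreal (p z))"
  proof (intro sum.cong refl)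
    fix z assume z: "z \<in> D"
    have "(\<integral>\<^sup>+y. ennreal (CN_density (v z + E) y) * ennreal ((cmod y)\<^sup>2 / (v z + E)) \<partial>lborel) =
      (\<integral>\<^sup>+y. ennreal (1 / (v z + E)) * ennreal (CN_density (v z + E) y * (cmod y)\<^sup>2) \<partial>lborel)"
      using z by (intro nn_integral_cong) (simp add: CN_density_nonneg flip: ennreal_mult')
    also have "\<dots> = ennreal (1 / (v z + E)) * ennreal (v z + E)"
      using z by (subst nn_integral_cmult) (simp_all add: nn_integral_CN_density_second_moment)
    also have "\<dots> = 1"
      using p_v_nonneg(3)[OF z] by (simp flip: ennreal_mult')
    finally show "ennreal (p z) * (\<integral>\<^sup>+y. ennreal (CN_density (v z + E) y) * ennreal ((cmod y)\<^sup>2 / (v z + E)) \<partial>lborel) = ennreal (p z)"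
      by simp
  qed
  finally show ?thesis
    by (simp add: sum_ennreal sum_p)
qed

lemma nn_integral_noise_second_moment:
  "(\<integral>\<^sup>+\<omega>. ennreal ((cmod (Y \<omega> - X \<omega>))\<^sup>2 / v (Z \<omega>)) \<partial>M) = 1"
proof -
  have [measurable]: "v \<in> borel_measurable (count_space D)" by simp
  have "(\<integral>\<^sup>+\<omega>. ennreal ((cmod (Y \<omega> - X \<omega>))\<^sup>2 / v (Z \<omega>)) \<partial>M) =
     (\<Sum>z\<in>D. ennreal (p z) * (\<integral>\<^sup>+x. \<integral>\<^sup>+w. ennreal ((cmod w)\<^sup>2 / v z) \<partial>CN0 (v z) \<partial>CN0 E))"
    using joint[of "\<lambda>(y, x, z). ennreal ((cmod (y - x))\<^sup>2 / v z)"] by simp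
  also have "\<dots> = (\<Sum>z\<in>D. ennreal (p z))"
  proof (intro sum.cong refl)
    fix z assume z: "z \<in> D"
    have "(\<integral>\<^sup>+w. ennreal ((cmod w)\<^sup>2 / v z) \<partial>CN0 (v z)) =
      (\<integral>\<^sup>+y. ennreal (1 / v z) * ennreal (CN_density (v z) y * (cmod y)\<^sup>2) \<partial>lborel)"
      using v[OF z] by (subst nn_integral_CN0)
        (auto intro!: nn_integral_cong simp: CN_density_nonneg simp flip: ennreal_mult')
    also have "\<dots> = ennreal (1 / v z) * ennreal (v z)"
      using v[OF z] by (subst nn_integral_cmult) (simp_all add: nn_integral_CN_density_second_moment)
    also have "\<dots> = 1"
      using v[OF z] by (simp flip: ennreal_mult')
    finally show "ennreal (p z) * (\<integral>\<^sup>+x. \<integral>\<^sup>+w. ennreal ((cmod w)\<^sup>2 / v z) \<partial>CN0 (v z) \<partial>CN0 E) = ennreal (p z)"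
      using E by simp
  qed
  finally show ?thesis
    by (simp add: sum_ennreal sum_p)
qed

lemma integrable_integral_nn_integral_1:
  assumes "f \<in> borel_measurable M" "\<And>\<omega>. \<omega> \<in> space M \<Longrightarrow> f \<omega> \<ge> 0"
    and "(\<integral>\<^sup>+\<omega>. ennreal (f \<omega>) \<partial>M) = 1"
  shows "integrable M f" "(\<integral>\<omega>. f \<omega> \<partial>M) = 1"
proof -
  have "AE \<omega> in M. 0 \<le> f \<omega>"
    using assms(2) by simp
  then show "integrable M f" "(\<integral>\<omega>. f \<omega> \<partial>M) = 1"
    using integrableI_nonneg[OF assms(1)] integral_eq_nn_integral[OF assms(1)] assms(3) by simp_all
qed

lemma Y_second_moment:
  shows integrable_Y_second_moment: "integrable M (\<lambda>\<omega>. (cmod (Y \<omega>))\<^sup>2 / (v (Z \<omega>) + E))" (is ?A)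
    and integral_Y_second_moment: "(\<integral>\<omega>. (cmod (Y \<omega>))\<^sup>2 / (v (Z \<omega>) + E) \<partial>M) = 1" (is ?B)
proof -
  have [measurable]: "v \<in> borel_measurable (count_space D)" by simp
  have nonneg: "(cmod (Y \<omega>))\<^sup>2 / (v (Z \<omega>) + E) \<ge> 0" if "\<omega> \<in> space M" for \<omega>
    using Z_in_D[OF that] by simp
  show ?A by (rule integrable_integral_nn_integral_1[OF _ nonneg nn_integral_Y_second_moment]) auto
  show ?B by (rule integrable_integral_nn_integral_1[OF _ nonneg nn_integral_Y_second_moment]) auto
qed

lemma noise_second_moment:
  shows integrable_noise_second_moment: "integrable M (\<lambda>\<omega>. (cmod (Y \<omega> - X \<omega>))\<^sup>2 / v (Z \<omega>))" (is ?A)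
    and integral_noise_second_moment: "(\<integral>\<omega>. (cmod (Y \<omega> - X \<omega>))\<^sup>2 / v (Z \<omega>) \<partial>M) = 1" (is ?B)
proof -
  have [measurable]: "v \<in> borel_measurable (count_space D)" by simp
  have nonneg: "(cmod (Y \<omega> - X \<omega>))\<^sup>2 / v (Z \<omega>) \<ge> 0" if "\<omega> \<in> space M" for \<omega>
    using Z_in_D[OF that] by simp
  show ?A by (rule integrable_integral_nn_integral_1[OF _ nonneg nn_integral_noise_second_moment]) auto
  show ?B by (rule integrable_integral_nn_integral_1[OF _ nonneg nn_integral_noise_second_moment]) auto
qed

text \<open>A mixture is at least any one of its terms, and at most \<open>1 / (pi * E)\<close>,
  because each component has variance at least \<open>E\<close> and the weights sum to 1. Applied
  with \<open>z\<close> the actual state, this dominates the logarithm by a normalised second moment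
  plus a function of the state.\<close>

lemma density_y_bounds:
  assumes z: "z \<in> D"
  shows "density_y y > 0"
    and "\<bar>ln (density_y y)\<bar> \<le> \<bar>ln (p z)\<bar> + \<bar>ln (pi * (v z + E))\<bar> + (cmod y)\<^sup>2 / (v z + E) + \<bar>ln (pi * E)\<bar>"
proof -
  have lower: "p z * CN_density (v z + E) y \<le> density_y y"
    unfolding density_y_def
    by (rule member_le_sum[OF z]) (simp_all add: D CN_density_nonneg)
  have pos: "p z * CN_density (v z + E) y > 0"
    using z p[OF z] by (simp add: CN_density_pos)
  show dpos: "density_y y > 0"
    using lower pos by linarith
  have "density_y y \<le> (\<Sum>z\<in>D. p z * (1 / (pi * E)))"
    unfolding density_y_def
  proof (intro sum_mono mult_left_mono)
    fix z assume z: "z \<in> D"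
    have "CN_density (v z + E) y \<le> 1 / (pi * (v z + E))"
      unfolding CN_density_def using p_v_nonneg[OF z] by (intro divide_right_mono) auto
    also have "\<dots> \<le> 1 / (pi * E)"
      using p_v_nonneg[OF z] E by (intro divide_left_mono mult_left_mono mult_pos_pos) auto
    finally show "CN_density (v z + E) y \<le> 1 / (pi * E)" .
  qed simp
  then have "density_y y \<le> 1 / (pi * E)"
    by (simp add: sum_divide_distrib[symmetric] sum_p)
  then have "ln (density_y y) \<le> ln (1 / (pi * E))"
    using dpos E by (subst ln_le_cancel_iff) auto
  also have "\<dots> = - ln (pi * E)"
    using E by (simp add: ln_div)
  finally have up: "ln (density_y y) \<le> - ln (pi * E)" .
  have "ln (p z * CN_density (v z + E) y) \<le> ln (density_y y)"
    using dpos pos lower by (subst ln_le_cancel_iff) auto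
  moreover have "ln (p z * CN_density (v z + E) y) = ln (p z) - (cmod y)\<^sup>2 / (v z + E) - ln (pi * (v z + E))"
    using p[OF z] z by (subst ln_mult_pos) (auto simp: CN_density_pos ln_CN_density)
  moreover have "(cmod y)\<^sup>2 / (v z + E) \<ge> 0"
    using z by simp
  ultimately show "\<bar>ln (density_y y)\<bar> \<le> \<bar>ln (p z)\<bar> + \<bar>ln (pi * (v z + E))\<bar> + (cmod y)\<^sup>2 / (v z + E) + \<bar>ln (pi * E)\<bar>"
    using up by linarith
qed

lemma integrable_ln_density_y: "integrable M (\<lambda>\<omega>. ln (density_y (Y \<omega>)))"
proof (rule Bochner_Integration.integrable_bound)
  show "integrable M (\<lambda>\<omega>. \<bar>ln (p (Z \<omega>))\<bar> + \<bar>ln (pi * (v (Z \<omega>) + E))\<bar> + (cmod (Y \<omega>))\<^sup>2 / (v (Z \<omega>) + E) + \<bar>ln (pi * E)\<bar>)"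
    using integrable_Z[of "\<lambda>z. \<bar>ln (p z)\<bar>"] integrable_Z[of "\<lambda>z. \<bar>ln (pi * (v z + E))\<bar>"]
      integrable_Y_second_moment
    by (intro Bochner_Integration.integrable_add) simp_all
  show "AE \<omega> in M. norm (ln (density_y (Y \<omega>))) \<le>
     norm (\<bar>ln (p (Z \<omega>))\<bar> + \<bar>ln (pi * (v (Z \<omega>) + E))\<bar> + (cmod (Y \<omega>))\<^sup>2 / (v (Z \<omega>) + E) + \<bar>ln (pi * E)\<bar>)"
    unfolding real_norm_def
    using order_trans[OF density_y_bounds(2)[OF Z_in_D] abs_ge_self] by (intro AE_I2)
qed measurable

text \<open>\<open>I1\<close> and \<open>I2\<close> are the integrability conditions for the
  information of \<open>Y\<close> about \<open>(X, Z)\<close> and about \<open>Z\<close>; each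
  integrand contains \<open>density_y\<close>. In the combined integrand \<open>L3\<close> the
  mixture is gone. What remains is the logarithm of a ratio of variances and two quadratic terms,
  both of mean 1.\<close>

lemma conditional_mutual_information:
  "conditional_mutual_information b lborel lborel (count_space D) Y X Z =
    (\<Sum>z\<in>D. p z * log b ((v z + E) / v z))"
proof -
  have [measurable]: "p \<in> borel_measurable (count_space D)" "v \<in> borel_measurable (count_space D)"
    by simp_all
  let ?N = "lborel \<Otimes>\<^sub>M lborel \<Otimes>\<^sub>M count_space D :: (complex \<times> complex \<times> 'z) measure"
  have nn: "density_yxz u \<ge> 0" if "u \<in> space ?N" for u
    using that v E by (auto simp: space_pair_measure density_yxz_def CN_density_nonneg)
  have C: "sigma_finite_measure (count_space D)"
    by (rule sigma_finite_measure_count_space_finite[OF D])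
  \<comment> \<open>Integrals against \<open>density_yxz\<close> are pulled back to expectations
    over \<open>M\<close>, where the moment lemmas apply.\<close>
  note transform = distributed_integrable[OF distributed_YXZ _ nn] distributed_integral[OF distributed_YXZ _ nn]
  let ?L1 = "\<lambda>(y, x, z). log b (density_yxz (y, x, z) / (density_y y * density_xz (x, z)))"
  let ?L2 = "\<lambda>(y, x, z). log b (density_yz (y, z) / (density_y y * p z))"
  let ?L3 = "\<lambda>(y, x, z). log b (density_yxz (y, x, z) / (density_yz (y, z) * (density_xz (x, z) / p z)))"
  have L1: "?L1 (Y \<omega>, X \<omega>, Z \<omega>) =
      (- ((cmod (Y \<omega> - X \<omega>))\<^sup>2 / v (Z \<omega>)) - ln (pi * v (Z \<omega>)) - ln (density_y (Y \<omega>))) / ln b"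
    if "\<omega> \<in> space M" for \<omega>
  proof -
    note z = Z_in_D[OF that]
    have eq: "density_yxz (Y \<omega>, X \<omega>, Z \<omega>) / (density_y (Y \<omega>) * density_xz (X \<omega>, Z \<omega>)) =
      CN_density (v (Z \<omega>)) (Y \<omega> - X \<omega>) / density_y (Y \<omega>)"
      using p[OF z] CN_density_pos[OF E, of "X \<omega>"] by (simp add: density_yxz_def density_xz_def)
    show ?thesis
      unfolding prod.case eq using density_y_bounds(1)[OF z, of "Y \<omega>"] CN_density_pos[OF v[OF z], of "Y \<omega> - X \<omega>"] v[OF z]
      by (simp add: log_def ln_div ln_CN_density)
  qed
  have L2: "?L2 (Y \<omega>, X \<omega>, Z \<omega>) =
      (- ((cmod (Y \<omega>))\<^sup>2 / (v (Z \<omega>) + E)) - ln (pi * (v (Z \<omega>) + E)) - ln (density_y (Y \<omega>))) / ln b"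
    if "\<omega> \<in> space M" for \<omega>
  proof -
    note z = Z_in_D[OF that]
    have eq: "density_yz (Y \<omega>, Z \<omega>) / (density_y (Y \<omega>) * p (Z \<omega>)) =
      CN_density (v (Z \<omega>) + E) (Y \<omega>) / density_y (Y \<omega>)"
      using p[OF z] by (simp add: density_yz_def)
    show ?thesis
      unfolding prod.case eq using density_y_bounds(1)[OF z, of "Y \<omega>"] CN_density_pos[OF p_v_nonneg(3)[OF z], of "Y \<omega>"] p_v_nonneg(3)[OF z]
      by (simp add: log_def ln_div ln_CN_density)
  qed
  have L3: "?L3 (Y \<omega>, X \<omega>, Z \<omega>) =
      log b ((v (Z \<omega>) + E) / v (Z \<omega>)) +
      ((cmod (Y \<omega>))\<^sup>2 / (v (Z \<omega>) + E) - (cmod (Y \<omega> - X \<omega>))\<^sup>2 / v (Z \<omega>)) / ln b"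
    if "\<omega> \<in> space M" for \<omega>
  proof -
    note z = Z_in_D[OF that]
    have eq: "density_yxz (Y \<omega>, X \<omega>, Z \<omega>) / (density_yz (Y \<omega>, Z \<omega>) * (density_xz (X \<omega>, Z \<omega>) / p (Z \<omega>))) =
      CN_density (v (Z \<omega>)) (Y \<omega> - X \<omega>) / CN_density (v (Z \<omega>) + E) (Y \<omega>)"
      using p[OF z] CN_density_pos[OF E, of "X \<omega>"] by (simp add: density_yxz_def density_xz_def density_yz_def)
    have ratio: "log b ((v (Z \<omega>) + E) / v (Z \<omega>)) = (ln (v (Z \<omega>) + E) - ln (v (Z \<omega>))) / ln b"
      unfolding log_def using v[OF z] p_v_nonneg(3)[OF z] by (subst ln_div) auto
    show ?thesis
      unfolding prod.case eq ratio using CN_density_pos[OF v[OF z], of "Y \<omega> - X \<omega>"] v[OF z]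
        CN_density_pos[OF p_v_nonneg(3)[OF z], of "Y \<omega>"] p_v_nonneg(3)[OF z]
      by (simp add: log_def ln_div ln_CN_density ln_mult_pos diff_divide_distrib add_divide_distrib)
  qed
  have I1: "integrable ?N (\<lambda>(y, x, z). density_yxz (y, x, z) *
      log b (density_yxz (y, x, z) / (density_y y * density_xz (x, z))))"
  proof -
    have "integrable ?N (\<lambda>u. density_yxz u * ?L1 u) \<longleftrightarrow> integrable M (\<lambda>\<omega>. ?L1 (Y \<omega>, X \<omega>, Z \<omega>))"
      by (rule transform(1)) (auto simp: split_beta')
    also have "\<dots> \<longleftrightarrow> integrable M (\<lambda>\<omega>. (- ((cmod (Y \<omega> - X \<omega>))\<^sup>2 / v (Z \<omega>)) - ln (pi * v (Z \<omega>)) - ln (density_y (Y \<omega>))) / ln b)"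
      by (rule Bochner_Integration.integrable_cong[OF refl L1])
    also have "\<dots>"
      using integrable_noise_second_moment integrable_Z[of "\<lambda>z. ln (pi * v z)"] integrable_ln_density_y
      by (intro integrable_divide Bochner_Integration.integrable_diff integrable_minus)
    finally show ?thesis
      by (simp add: split_beta')
  qed
  have I2: "integrable ?N (\<lambda>(y, x, z). density_yxz (y, x, z) *
      log b (density_yz (y, z) / (density_y y * p z)))"
  proof -
    have "integrable ?N (\<lambda>u. density_yxz u * ?L2 u) \<longleftrightarrow> integrable M (\<lambda>\<omega>. ?L2 (Y \<omega>, X \<omega>, Z \<omega>))"
      by (rule transform(1)) (auto simp: split_beta')
    also have "\<dots> \<longleftrightarrow> integrable M (\<lambda>\<omega>. (- ((cmod (Y \<omega>))\<^sup>2 / (v (Z \<omega>) + E)) - ln (pi * (v (Z \<omega>) + E)) - ln (density_y (Y \<omega>))) / ln b)"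
      by (rule Bochner_Integration.integrable_cong[OF refl L2])
    also have "\<dots>"
      using integrable_Y_second_moment integrable_Z[of "\<lambda>z. ln (pi * (v z + E))"] integrable_ln_density_y
      by (intro integrable_divide Bochner_Integration.integrable_diff integrable_minus)
    finally show ?thesis
      by (simp add: split_beta')
  qed
  have nonneg: "density_y y \<ge> 0" "z \<in> space (count_space D) \<Longrightarrow> p z \<ge> 0"
      "z \<in> space (count_space D) \<Longrightarrow> density_xz (y, z) \<ge> 0"
      "z \<in> space (count_space D) \<Longrightarrow> density_yz (y, z) \<ge> 0"
      "z \<in> space (count_space D) \<Longrightarrow> density_yxz (y, x, z) \<ge> 0" for x y z
    using E v by (auto simp: density_y_def density_xz_def density_yz_def density_yxz_def
        CN_density_nonneg intro!: sum_nonneg)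
  have "conditional_mutual_information b lborel lborel (count_space D) Y X Z =
    (\<integral>(y, x, z). density_yxz (y, x, z) *
      log b (density_yxz (y, x, z) / (density_yz (y, z) * (density_xz (x, z) / p z))) \<partial>?N)"
    by (rule conditional_mutual_information_generic_eq[OF sigma_finite_lborel sigma_finite_lborel C
        distributed_Y nonneg(1) distributed_Z nonneg(2) distributed_XZ nonneg(3)
        distributed_YZ nonneg(4) distributed_YXZ nonneg(5) I1 I2])
  also have "\<dots> = (\<integral>u. density_yxz u * ?L3 u \<partial>?N)"
    by (simp add: split_beta')
  also have "\<dots> = (\<integral>\<omega>. ?L3 (Y \<omega>, X \<omega>, Z \<omega>) \<partial>M)"
    by (rule transform(2)) (auto simp: split_beta')
  also have "\<dots> = (\<integral>\<omega>. log b ((v (Z \<omega>) + E) / v (Z \<omega>)) +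
      ((cmod (Y \<omega>))\<^sup>2 / (v (Z \<omega>) + E) - (cmod (Y \<omega> - X \<omega>))\<^sup>2 / v (Z \<omega>)) / ln b \<partial>M)"
    by (rule Bochner_Integration.integral_cong[OF refl L3])
  also have "\<dots> = (\<integral>\<omega>. log b ((v (Z \<omega>) + E) / v (Z \<omega>)) \<partial>M)"
    using integrable_Z[of "\<lambda>z. log b ((v z + E) / v z)"] Y_second_moment noise_second_moment
    by simp
  also have "\<dots> = (\<Sum>z\<in>D. p z * log b ((v z + E) / v z))"
  proof -
    have "(\<integral>\<omega>. log b ((v (Z \<omega>) + E) / v (Z \<omega>)) \<partial>M) = (\<integral>z. p z * log b ((v z + E) / v z) \<partial>count_space D)"
      by (rule distributed_integral[OF distributed_Z, symmetric]) auto
    then show ?thesis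
      using D by (simp add: lebesgue_integral_count_space_finite)
  qed
  finally show ?thesis .
qed

end

section \<open>The matched filter channel\<close>

text \<open>Since \<open>t\<close> is positive, the total variance is positive even if all
  coefficients vanish, so a single \<open>CN0\<close> can stand on the right.\<close>

lemma nn_integral_CN0_interference:
  fixes c :: "'i \<Rightarrow> real"
  assumes "s > 0" "t > 0" "finite J" and [measurable]: "f \<in> borel_measurable borel"
  shows "(\<integral>\<^sup>+b. \<integral>\<^sup>+z. f (w + (\<Sum>j\<in>J. of_real (c j) * b j) + z) \<partial>CN0 t \<partial>PiM J (\<lambda>_. CN0 s)) =
    (\<integral>\<^sup>+y. f (w + y) \<partial>CN0 (t + s * (\<Sum>j\<in>J. (c j)\<^sup>2)))"
proof -
  interpret CN1: prob_space "CN0 1" by (rule prob_space_CN0) simp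
  interpret CNt: prob_space "CN0 t" by (rule prob_space_CN0) fact
  define V where "V = (\<Sum>j\<in>J. (c j)\<^sup>2) * s"
  have "(\<integral>\<^sup>+b. \<integral>\<^sup>+z. f (w + (\<Sum>j\<in>J. of_real (c j) * b j) + z) \<partial>CN0 t \<partial>PiM J (\<lambda>_. CN0 s)) =
    (\<integral>\<^sup>+x. \<integral>\<^sup>+z. f (w + of_real (sqrt V) * x + z) \<partial>CN0 t \<partial>CN0 1)"
    unfolding V_def using assms by (intro nn_integral_PiM_CN0_sum) auto
  also have "\<dots> = (\<integral>\<^sup>+y. f (w + y) \<partial>CN0 (t + V))"
  proof (cases "V = 0")
    case True
    show ?thesis unfolding True by simp
  next
    case False
    moreover have "V \<ge> 0"
      using assms(1) by (simp add: V_def sum_nonneg)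
    ultimately have "V > 0" by simp
    then show ?thesis
      using nn_integral_CN0_scale[of 1 "sqrt V" "\<lambda>x. \<integral>\<^sup>+z. f (w + x + z) \<partial>CN0 t"]
        nn_integral_CN0_add[of t V "\<lambda>x. f (w + x)"] assms(2)
      by (simp add: add.assoc)
  qed
  finally show ?thesis by (simp add: V_def mult.commute)
qed

text \<open>The point is that \<open>f\<close> is in general not measurable: it leaves the space of \<open>N\<close> on the null set \<open>U\<close>.\<close>
lemma distr_eq_outside_space:
  assumes g[measurable]: "g \<in> measurable M L" and U: "U \<in> null_sets M"
    and eq: "\<And>x. x \<in> space M - U \<Longrightarrow> f x = g x" and out: "\<And>x. x \<in> U \<Longrightarrow> f x \<notin> space N"
    and sets: "sets N = sets L"
  shows "distr M N f = distr M L g"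
proof -
  \<comment> \<open>\<open>distr\<close> depends on its map only through the masses of preimages,
    and the preimages under \<open>f\<close> and \<open>g\<close> differ by a part of the null set
    \<open>U\<close>.\<close>
  have "emeasure M (f -` A \<inter> space M) = emeasure M (g -` A \<inter> space M)" if "A \<in> sets L" for A
  proof -
    have out_A: "f x \<notin> A" if "x \<in> U" for x
      using out[OF that] sets.sets_into_space[of A N] \<open>A \<in> sets L\<close> by (auto simp: sets)
    have "f -` A \<inter> space M = g -` A \<inter> space M - U"
    proof (intro set_eqI)
      fix x show "x \<in> f -` A \<inter> space M \<longleftrightarrow> x \<in> g -` A \<inter> space M - U"
        using eq[of x] out_A[of x] by (cases "x \<in> U") auto
    qed
    then show ?thesis
      using emeasure_Diff_null_set[OF U measurable_sets[OF g that]] by simp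
  qed
  then show ?thesis
    unfolding distr_def sets sets_eq_imp_space_eq[OF sets]
    by (intro measure_of_eq) (auto simp: sets.space_closed sets.sigma_sets_eq)
qed

section \<open>Correlations and energy of time-hopping signatures\<close>

definition correlation :: "nat \<Rightarrow> (nat \<Rightarrow> nat \<Rightarrow> real) \<Rightarrow> nat \<Rightarrow> real" where
  "correlation N S j = (\<Sum>i<N. S 0 i * S j i)"

lemma mf_out_eq:
  "mf_out Ns Nh K (S, b, n) =
    (\<Sum>j<K. of_real (correlation (Ns * Nh) S j) * b j) + (\<Sum>i<Ns * Nh. of_real (S 0 i) * n i)"
  unfolding mf_out_def rx_def correlation_def
  by (simp add: distrib_left sum.distrib sum_distrib_left sum_distrib_right mult.assoc, rule sum.swap)

lemma seq_of_block:
  assumes "m < Ns" "r < Nh"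
  shows "seq_of Ns Nh c (m * Nh + r) = (if r = fst (c m) then (if snd (c m) then 1 else -1) / sqrt (real Ns) else 0)"
proof -
  have "m * Nh + r < Ns * Nh"
  proof -
    have "m * Nh + r < Suc m * Nh" using assms(2) by simp
    also have "\<dots> \<le> Ns * Nh" using assms(1) by (intro mult_le_mono1) simp
    finally show ?thesis .
  qed
  then show ?thesis
    using assms by (simp add: seq_of_def)
qed

text \<open>The indices are grouped into \<open>Ns\<close> blocks of length \<open>Nh\<close>.
  Within a block each factor has one pulse, so the product survives only where the pulses coincide,
  and there it is plus or minus \<open>1 / Ns\<close>.\<close>

lemma sum_seq_of_mult:
  assumes c: "\<And>m. m < Ns \<Longrightarrow> fst (c m) < Nh"
  shows "(\<Sum>i<Ns * Nh. seq_of Ns Nh c i * seq_of Ns Nh c' i) =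
    (\<Sum>m<Ns. if fst (c m) = fst (c' m) then (if snd (c m) = snd (c' m) then 1 else - 1) / real Ns else 0)"
proof -
  let ?f = "\<lambda>i. seq_of Ns Nh c i * seq_of Ns Nh c' i"
  have "(\<Sum>i<Ns * Nh. ?f i) = (\<Sum>m<Ns. \<Sum>i\<in>{m * Nh..<m * Nh + Nh}. ?f i)"
    by (rule sum.nat_group[symmetric])
  also have "\<dots> = (\<Sum>m<Ns. \<Sum>r<Nh. ?f (m * Nh + r))"
  proof (rule sum.cong[OF refl])
    fix m
    show "(\<Sum>i\<in>{m * Nh..<m * Nh + Nh}. ?f i) = (\<Sum>r<Nh. ?f (m * Nh + r))"
      using sum.shift_bounds_nat_ivl[of ?f 0 "m * Nh" Nh] by (simp add: lessThan_atLeast0 add.commute)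
  qed
  also have "\<dots> = (\<Sum>m<Ns. if fst (c m) = fst (c' m) then (if snd (c m) = snd (c' m) then 1 else - 1) / real Ns else 0)"
  proof (intro sum.cong refl)
    fix m assume "m \<in> {..<Ns}"
    then have m: "m < Ns" by simp
    have "(\<Sum>r<Nh. ?f (m * Nh + r)) = (\<Sum>r<Nh. if r = fst (c m) then
        (if fst (c m) = fst (c' m) then (if snd (c m) = snd (c' m) then 1 else - 1) / real Ns else 0) else 0)"
      using m by (intro sum.cong refl) (auto simp: seq_of_block)
    then show "(\<Sum>r<Nh. ?f (m * Nh + r)) =
        (if fst (c m) = fst (c' m) then (if snd (c m) = snd (c' m) then 1 else - 1) / real Ns else 0)"
      using c[OF m] by simp
  qed
  finally show ?thesis .
qed

text \<open>The law of pulse positions and signs behind a signature. Estimates are made at this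
  level because the blocks are independent coordinates here.\<close>

definition choice_pmf :: "nat \<Rightarrow> nat \<Rightarrow> (nat \<Rightarrow> nat \<times> bool) pmf" where
  "choice_pmf Ns Nh = Pi_pmf {..<Ns} (0, True) (\<lambda>_. pair_pmf (pmf_of_set {..<Nh}) (pmf_of_set UNIV))"

lemma NsNh_seq_eq: "NsNh_seq Ns Nh = map_pmf (seq_of Ns Nh) (choice_pmf Ns Nh)"
  by (simp add: NsNh_seq_def choice_pmf_def)

lemma set_choice_pmf:
  assumes "Nh \<ge> 1"
  shows "set_pmf (choice_pmf Ns Nh) = PiE_dflt {..<Ns} (0, True) (\<lambda>_. {..<Nh} \<times> UNIV)"
proof -
  have "set_pmf (pmf_of_set {..<Nh}) = {..<Nh}"
    using assms by (intro set_pmf_of_set) (auto simp: lessThan_empty_iff)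
  then show ?thesis
    by (simp add: choice_pmf_def set_Pi_pmf o_def)
qed

lemma choice_pmf_less: "Nh \<ge> 1 \<Longrightarrow> c \<in> set_pmf (choice_pmf Ns Nh) \<Longrightarrow> m < Ns \<Longrightarrow> fst (c m) < Nh"
  by (auto simp: set_choice_pmf PiE_dflt_def)

lemma finite_set_choice_pmf: "Nh \<ge> 1 \<Longrightarrow> finite (set_pmf (choice_pmf Ns Nh))"
  by (simp add: set_choice_pmf finite_PiE_dflt)

lemma finite_set_spread_pmf:
  assumes "Nh \<ge> 1"
  shows "finite (set_pmf (spread_pmf Ns Nh K))"
  using assms
  by (auto simp: spread_pmf_def set_Pi_pmf NsNh_seq_eq finite_set_choice_pmf intro!: finite_PiE_dflt)

text \<open>There are \<open>Ns\<close> pulses of energy \<open>1 / Ns\<close> each. Unit energy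
  gives user 1, who has index 0, gain 1 through the matched filter and preserves the noise
  variance.\<close>

lemma spread_pmf_energy:
  assumes "Ns \<ge> 1" "Nh \<ge> 1" "K \<ge> 1" "S \<in> set_pmf (spread_pmf Ns Nh K)"
  shows "(\<Sum>i<Ns * Nh. (S 0 i)\<^sup>2) = 1"
proof -
  have "S 0 \<in> set_pmf (NsNh_seq Ns Nh)"
    using assms by (auto simp: spread_pmf_def set_Pi_pmf PiE_dflt_def)
  then obtain c where c: "c \<in> set_pmf (choice_pmf Ns Nh)" "S 0 = seq_of Ns Nh c"
    by (auto simp: NsNh_seq_eq)
  show ?thesis
    using sum_seq_of_mult[of Ns c Nh c] choice_pmf_less[OF assms(2) c(1)] assms(1)
    by (simp add: c(2) power2_eq_square)
qed

definition interference :: "nat \<Rightarrow> nat \<Rightarrow> (nat \<Rightarrow> nat \<Rightarrow> real) \<Rightarrow> real" where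
  "interference N K S = (\<Sum>j\<in>{1..<K}. (correlation N S j)\<^sup>2)"

lemma interference_nonneg: "interference N K S \<ge> 0"
  by (simp add: interference_def sum_nonneg)

text \<open>The conditional variance, given \<open>S\<close>, of the matched filter output minus the
  desired symbol.\<close>

definition noise_var :: "nat \<Rightarrow> nat \<Rightarrow> real \<Rightarrow> real \<Rightarrow> (nat \<Rightarrow> nat \<Rightarrow> real) \<Rightarrow> real" where
  "noise_var N K E N0 S = N0 + E * interference N K S"

section \<open>The law of the matched filter output for a given spreading matrix\<close>

context
  fixes Ns Nh K :: nat and E N0 :: real
  assumes Ns: "Ns \<ge> 1" and Nh: "Nh \<ge> 1" and K: "K \<ge> 1" and E: "E > 0" and N0: "N0 > 0"
begin

interpretation CE: prob_space "CN0 E" by (rule prob_space_CN0[OF E])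
interpretation CN: prob_space "CN0 N0" by (rule prob_space_CN0[OF N0])
interpretation PE: product_prob_space "\<lambda>_. CN0 E" "{..<K}" ..
interpretation PN: product_prob_space "\<lambda>_. CN0 N0" "{..<Ns * Nh}" ..
interpretation PEs: product_sigma_finite "\<lambda>_. CN0 E" ..
interpretation R: pair_prob_space "PiM {..<K} (\<lambda>_. CN0 E)" "PiM {..<Ns * Nh} (\<lambda>_. CN0 N0)" ..
interpretation W: pair_prob_space "measure_pmf (spread_pmf Ns Nh K)"
  "PiM {..<K} (\<lambda>_. CN0 E) \<Otimes>\<^sub>M PiM {..<Ns * Nh} (\<lambda>_. CN0 N0)" ..

lemma prob_space_cdma_space: "prob_space (cdma_space Ns Nh K E N0)"
  unfolding cdma_space_def by (rule W.P.prob_space_axioms)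

lemma measurable_fst_cdma[measurable]: "fst \<in> measurable (cdma_space Ns Nh K E N0) (count_space UNIV)"
  unfolding cdma_space_def by measurable

lemma measurable_entry_cdma[measurable]: "(\<lambda>\<omega>. fst \<omega> j i) \<in> borel_measurable (cdma_space Ns Nh K E N0)"
  by (rule measurable_compose[OF measurable_fst_cdma]) simp

lemma measurable_symbol_cdma[measurable]:
  "j < K \<Longrightarrow> (\<lambda>\<omega>. fst (snd \<omega>) j) \<in> borel_measurable (cdma_space Ns Nh K E N0)"
  unfolding cdma_space_def by measurable

lemma measurable_noise_cdma[measurable]:
  "i < Ns * Nh \<Longrightarrow> (\<lambda>\<omega>. snd (snd \<omega>) i) \<in> borel_measurable (cdma_space Ns Nh K E N0)"
  unfolding cdma_space_def by measurable

lemma measurable_mf_out[measurable]: "mf_out Ns Nh K \<in> borel_measurable (cdma_space Ns Nh K E N0)"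
  unfolding mf_out_def[abs_def] rx_def Let_def split_beta'
  by (intro borel_measurable_sum borel_measurable_times borel_measurable_add borel_measurable_of_real) auto

lemma measurable_sym1[measurable]: "sym1 \<in> borel_measurable (cdma_space Ns Nh K E N0)"
  unfolding sym1_def[abs_def] using K by (intro measurable_symbol_cdma) simp

lemma noise_var_pos: "noise_var N K E N0 S > 0"
  using E N0 by (simp add: noise_var_def interference_nonneg add_pos_nonneg)

lemma nn_integral_noise:
  assumes "(\<Sum>i<Ns * Nh. (a i)\<^sup>2) = 1" and [measurable]: "f \<in> borel_measurable borel"
  shows "(\<integral>\<^sup>+n. f (w + (\<Sum>i<Ns * Nh. of_real (a i) * n i)) \<partial>PiM {..<Ns * Nh} (\<lambda>_. CN0 N0)) =
    (\<integral>\<^sup>+z. f (w + z) \<partial>CN0 N0)"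
  using nn_integral_PiM_CN0_sum[OF N0, of "{..<Ns * Nh}" f w a]
    nn_integral_CN0_scale[of 1 "sqrt N0" "\<lambda>z. f (w + z)"] N0
  by (simp add: assms(1))

text \<open>For a fixed matrix the filtered noise is again Gaussian of variance \<open>N0\<close>,
  the desired symbol enters with gain 1, and the other symbols merge with the noise into one
  Gaussian.\<close>

lemma nn_integral_mf_out_sym1:
  assumes S: "S \<in> set_pmf (spread_pmf Ns Nh K)"
    and g[measurable]: "g \<in> borel_measurable (borel \<Otimes>\<^sub>M borel)"
  shows "(\<integral>\<^sup>+u. g (mf_out Ns Nh K (S, u), fst u 0)
      \<partial>(PiM {..<K} (\<lambda>_. CN0 E) \<Otimes>\<^sub>M PiM {..<Ns * Nh} (\<lambda>_. CN0 N0))) =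
    (\<integral>\<^sup>+x. \<integral>\<^sup>+w. g (x + w, x) \<partial>CN0 (noise_var (Ns * Nh) K E N0 S) \<partial>CN0 E)"
proof -
  let ?\<rho> = "correlation (Ns * Nh) S"
  have energy: "(\<Sum>i<Ns * Nh. (S 0 i)\<^sup>2) = 1"
    by (rule spread_pmf_energy[OF Ns Nh K S])
  then have \<rho>0: "?\<rho> 0 = 1"
    by (simp add: correlation_def power2_eq_square)
  have lessThan_K: "{..<K} = insert 0 {1..<K}"
    using K by auto
  have [measurable]: "(\<lambda>b. b j) \<in> borel_measurable (PiM {..<K} (\<lambda>_. CN0 E))" if "j < K" for j
    using measurable_component_singleton[of j "{..<K}" "\<lambda>_. CN0 E"] that
    by (simp add: measurable_cong_sets[OF refl sets_CN0])
  have [measurable]: "(\<lambda>b. b 0) \<in> borel_measurable (PiM {..<K} (\<lambda>_. CN0 E))"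
    using K by simp
  have "(\<integral>\<^sup>+u. g (mf_out Ns Nh K (S, u), fst u 0) \<partial>(PiM {..<K} (\<lambda>_. CN0 E) \<Otimes>\<^sub>M PiM {..<Ns * Nh} (\<lambda>_. CN0 N0))) =
    (\<integral>\<^sup>+b. \<integral>\<^sup>+n. g ((\<Sum>j<K. of_real (?\<rho> j) * b j) + (\<Sum>i<Ns * Nh. of_real (S 0 i) * n i), b 0)
       \<partial>PiM {..<Ns * Nh} (\<lambda>_. CN0 N0) \<partial>PiM {..<K} (\<lambda>_. CN0 E))"
  proof -
    have [measurable]: "(\<lambda>u. mf_out Ns Nh K (S, u)) \<in> borel_measurable
        (PiM {..<K} (\<lambda>_. CN0 E) \<Otimes>\<^sub>M PiM {..<Ns * Nh} (\<lambda>_. CN0 N0))"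
      using measurable_compose[OF measurable_Pair1' measurable_mf_out[unfolded cdma_space_def], of S]
      by simp
    show ?thesis
      by (subst PN.nn_integral_fst[symmetric]) (simp_all add: mf_out_eq)
  qed
  also have "\<dots> = (\<integral>\<^sup>+b. \<integral>\<^sup>+z. g ((\<Sum>j<K. of_real (?\<rho> j) * b j) + z, b 0) \<partial>CN0 N0 \<partial>PiM {..<K} (\<lambda>_. CN0 E))"
    using nn_integral_noise[OF energy, of "\<lambda>y. g (y, _)"] by simp
  \<comment> \<open>The symbol with index 0 is split off as the outer variable; the remaining
    coordinates are the interferers.\<close>
  also have "\<dots> = (\<integral>\<^sup>+x. \<integral>\<^sup>+b. \<integral>\<^sup>+z. g ((\<Sum>j<K. of_real (?\<rho> j) * (b(0 := x)) j) + z, (b(0 := x)) 0)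
      \<partial>CN0 N0 \<partial>PiM {1..<K} (\<lambda>_. CN0 E) \<partial>CN0 E)"
    unfolding lessThan_K by (subst PEs.product_nn_integral_insert_rev) (simp_all add: lessThan_K[symmetric])
  also have "\<dots> = (\<integral>\<^sup>+x. \<integral>\<^sup>+b. \<integral>\<^sup>+z. g (x + (\<Sum>j\<in>{1..<K}. of_real (?\<rho> j) * b j) + z, x)
      \<partial>CN0 N0 \<partial>PiM {1..<K} (\<lambda>_. CN0 E) \<partial>CN0 E)"
  proof (intro nn_integral_cong arg_cong[where f = g])
    fix x z and b :: "nat \<Rightarrow> complex"
    have "(\<Sum>j<K. of_real (?\<rho> j) * (b(0 := x)) j) = x + (\<Sum>j\<in>{1..<K}. of_real (?\<rho> j) * (b(0 := x)) j)"
      unfolding lessThan_K by (simp add: \<rho>0)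
    also have "(\<Sum>j\<in>{1..<K}. of_real (?\<rho> j) * (b(0 := x)) j) = (\<Sum>j\<in>{1..<K}. of_real (?\<rho> j) * b j)"
      by (intro sum.cong) auto
    finally show "((\<Sum>j<K. of_real (?\<rho> j) * (b(0 := x)) j) + z, (b(0 := x)) 0) =
        (x + (\<Sum>j\<in>{1..<K}. of_real (?\<rho> j) * b j) + z, x)"
      by simp
  qed
  also have "\<dots> = (\<integral>\<^sup>+x. \<integral>\<^sup>+w. g (x + w, x) \<partial>CN0 (noise_var (Ns * Nh) K E N0 S) \<partial>CN0 E)"
    using nn_integral_CN0_interference[OF E N0, of "{1..<K}" "\<lambda>y. g (y, _)"]
    by (simp add: noise_var_def interference_def)
  finally show ?thesis .
qed

lemma MI_mf_eq_sum:
  "MI_mf Ns Nh K E N0 = (\<Sum>S\<in>set_pmf (spread_pmf Ns Nh K). pmf (spread_pmf Ns Nh K) S *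
     log 2 ((noise_var (Ns * Nh) K E N0 S + E) / noise_var (Ns * Nh) K E N0 S))"
proof -
  let ?P = "spread_pmf Ns Nh K" and ?M = "cdma_space Ns Nh K E N0"
  let ?D = "set_pmf ?P"
  let ?v = "noise_var (Ns * Nh) K E N0"
  let ?R = "PiM {..<K} (\<lambda>_. CN0 E) \<Otimes>\<^sub>M PiM {..<Ns * Nh} (\<lambda>_. CN0 N0)"
  let ?Y = "mf_out Ns Nh K"
  interpret M: prob_space ?M by (rule prob_space_cdma_space)
  interpret M: information_space ?M 2 by standard simp
  have D: "finite ?D" by (rule finite_set_spread_pmf[OF Nh])
  obtain S0 where S0: "S0 \<in> ?D" using set_pmf_not_empty[of ?P] by blast
  txt \<open>\<open>fst\<close> is not measurable into \<open>count_space ?D\<close>, because it takes values outside \<open>?D\<close> on a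
    null set; \<open>Z\<close> repairs this without changing any of the distributions.\<close>
  define Z where "Z = (\<lambda>\<omega> :: (nat \<Rightarrow> nat \<Rightarrow> real) \<times> (nat \<Rightarrow> complex) \<times> (nat \<Rightarrow> complex).
    if fst \<omega> \<in> ?D then fst \<omega> else S0)"
  have Z[measurable]: "Z \<in> measurable ?M (count_space ?D)"
    unfolding Z_def by (rule measurable_compose[OF measurable_fst_cdma]) (use S0 in auto)
  interpret gaussian_mixture ?M 2 sym1 ?Y Z "pmf ?P" ?v ?D E
  proof unfold_locales
    fix g :: "complex \<times> complex \<times> (nat \<Rightarrow> nat \<Rightarrow> real) \<Rightarrow> ennreal"
    assume g[measurable]: "g \<in> borel_measurable (borel \<Otimes>\<^sub>M borel \<Otimes>\<^sub>M count_space ?D)"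
    have "(\<integral>\<^sup>+\<omega>. g (?Y \<omega>, sym1 \<omega>, Z \<omega>) \<partial>?M) = (\<integral>\<^sup>+S. \<integral>\<^sup>+u. g (?Y (S, u), sym1 (S, u), Z (S, u)) \<partial>?R \<partial>measure_pmf ?P)"
    proof -
      have "(\<lambda>\<omega>. g (?Y \<omega>, sym1 \<omega>, Z \<omega>)) \<in> borel_measurable (measure_pmf ?P \<Otimes>\<^sub>M ?R)"
        unfolding cdma_space_def[symmetric] by measurable
      from sigma_finite_measure.nn_integral_fst[OF prob_space_imp_sigma_finite[OF R.P.prob_space_axioms] this] show ?thesis
        unfolding cdma_space_def by simp
    qed
    also have "\<dots> = (\<Sum>S\<in>?D. ennreal (pmf ?P S) * (\<integral>\<^sup>+u. g (?Y (S, u), sym1 (S, u), Z (S, u)) \<partial>?R))"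
      using D by (subst nn_integral_measure_pmf_finite) (simp_all add: mult.commute)
    also have "\<dots> = (\<Sum>S\<in>?D. ennreal (pmf ?P S) * (\<integral>\<^sup>+x. \<integral>\<^sup>+w. g (x + w, x, S) \<partial>CN0 (?v S) \<partial>CN0 E))"
    proof (intro sum.cong refl arg_cong[where f = "(*) _"])
      fix S assume S: "S \<in> ?D"
      have "(\<integral>\<^sup>+u. g (?Y (S, u), sym1 (S, u), Z (S, u)) \<partial>?R) =
          (\<integral>\<^sup>+u. (\<lambda>(y, x). g (y, x, S)) (?Y (S, u), fst u 0) \<partial>?R)"
        using S by (simp add: Z_def sym1_def)
      also have "\<dots> = (\<integral>\<^sup>+x. \<integral>\<^sup>+w. (\<lambda>(y, x). g (y, x, S)) (x + w, x) \<partial>CN0 (?v S) \<partial>CN0 E)"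
        using borel_measurable_section_count_space2[OF g S]
        by (intro nn_integral_mf_out_sym1[OF S]) (simp add: split_beta')
      finally show "(\<integral>\<^sup>+u. g (?Y (S, u), sym1 (S, u), Z (S, u)) \<partial>?R) =
          (\<integral>\<^sup>+x. \<integral>\<^sup>+w. g (x + w, x, S) \<partial>CN0 (?v S) \<partial>CN0 E)"
        by simp
    qed
    finally show "(\<integral>\<^sup>+\<omega>. g (?Y \<omega>, sym1 \<omega>, Z \<omega>) \<partial>?M) =
      (\<Sum>S\<in>?D. ennreal (pmf ?P S) * (\<integral>\<^sup>+x. \<integral>\<^sup>+w. g (x + w, x, S) \<partial>CN0 (?v S) \<partial>CN0 E))" .
  qed (use E D noise_var_pos in \<open>auto simp: pmf_positive\<close>)
  let ?U = "{\<omega> \<in> space ?M. fst \<omega> \<notin> ?D}"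
  have U: "?U \<in> null_sets ?M"
  proof -
    have sets: "{\<omega> \<in> space ?M. fst \<omega> \<in> ?D} \<in> sets ?M" "?U \<in> sets ?M"
      by measurable
    have "AE \<omega> in measure_pmf ?P \<Otimes>\<^sub>M ?R. fst \<omega> \<in> ?D"
      using sets(1) unfolding cdma_space_def by (rule W.AE_pair_measure) (simp add: AE_measure_pmf_iff)
    then show ?thesis
      unfolding cdma_space_def[symmetric] using sets(2) by (subst (asm) AE_iff_null) auto
  qed
  have m: "(\<lambda>\<omega>. (sym1 \<omega>, Z \<omega>)) \<in> measurable ?M (lborel \<Otimes>\<^sub>M count_space ?D)"
      "(\<lambda>\<omega>. (?Y \<omega>, sym1 \<omega>, Z \<omega>)) \<in> measurable ?M (lborel \<Otimes>\<^sub>M lborel \<Otimes>\<^sub>M count_space ?D)"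
      "(\<lambda>\<omega>. (?Y \<omega>, Z \<omega>)) \<in> measurable ?M (lborel \<Otimes>\<^sub>M count_space ?D)"
    by measurable
  \<comment> \<open>Mutual information sees its variables only through distributions, and
    \<open>distr\<close> uses only the measurable sets of its target. So \<open>fst\<close> can be
    traded for \<open>Z\<close> and \<open>borel\<close> for \<open>lborel\<close> in each of the
    five distributions that occur.\<close>
  have d1: "distr ?M (borel \<Otimes>\<^sub>M count_space ?D) (\<lambda>\<omega>. (sym1 \<omega>, fst \<omega>)) =
      distr ?M (lborel \<Otimes>\<^sub>M count_space ?D) (\<lambda>\<omega>. (sym1 \<omega>, Z \<omega>))"
    by (rule distr_eq_outside_space[OF m(1) U]) (auto simp: Z_def space_pair_measure intro!: sets_pair_measure_cong)
  have d2: "distr ?M (borel \<Otimes>\<^sub>M borel \<Otimes>\<^sub>M count_space ?D) (\<lambda>\<omega>. (?Y \<omega>, sym1 \<omega>, fst \<omega>)) =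
      distr ?M (lborel \<Otimes>\<^sub>M lborel \<Otimes>\<^sub>M count_space ?D) (\<lambda>\<omega>. (?Y \<omega>, sym1 \<omega>, Z \<omega>))"
    by (rule distr_eq_outside_space[OF m(2) U]) (auto simp: Z_def space_pair_measure intro!: sets_pair_measure_cong)
  have d3: "distr ?M (count_space ?D) fst = distr ?M (count_space ?D) Z"
    by (rule distr_eq_outside_space[OF Z U]) (auto simp: Z_def)
  have d4: "distr ?M (borel \<Otimes>\<^sub>M count_space ?D) (\<lambda>\<omega>. (?Y \<omega>, fst \<omega>)) =
      distr ?M (lborel \<Otimes>\<^sub>M count_space ?D) (\<lambda>\<omega>. (?Y \<omega>, Z \<omega>))"
    by (rule distr_eq_outside_space[OF m(3) U]) (auto simp: Z_def space_pair_measure intro!: sets_pair_measure_cong)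
  have d5: "distr ?M borel ?Y = distr ?M lborel ?Y"
    by (rule distr_cong) auto
  have "MI_mf Ns Nh K E N0 = M.conditional_mutual_information 2 lborel lborel (count_space ?D) ?Y sym1 Z"
    unfolding MI_mf_def M.conditional_mutual_information_def M.mutual_information_def d1 d2 d3 d4 d5 ..
  then show ?thesis
    by (simp add: conditional_mutual_information)
qed

end

section \<open>Poisson limit of the interference\<close>

lemma integrable_measure_pmf_bounded:
  fixes f :: "'a \<Rightarrow> real"
  assumes "\<And>x. \<bar>f x\<bar> \<le> B"
  shows "integrable (measure_pmf p) f"
  by (rule measure_pmf.integrable_const_bound[of _ B]) (use assms in auto)

lemma pmf_expectation_diff_le:
  fixes f g :: "'a \<Rightarrow> real"
  assumes "integrable (measure_pmf p) f" "integrable (measure_pmf p) g" "\<And>x. x \<in> set_pmf p \<Longrightarrow> \<bar>f x - g x\<bar> \<le> B"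
  shows "\<bar>measure_pmf.expectation p f - measure_pmf.expectation p g\<bar> \<le> B"
proof -
  have "\<bar>measure_pmf.expectation p (\<lambda>x. f x - g x)\<bar> \<le> measure_pmf.expectation p (\<lambda>x. \<bar>f x - g x\<bar>)"
    by (rule integral_abs_bound)
  also have "\<dots> \<le> measure_pmf.expectation p (\<lambda>_. B)"
    using assms by (intro integral_mono_AE) (auto simp: AE_measure_pmf_iff)
  finally show ?thesis
    using assms by simp
qed

text \<open>The substitution \<open>u = exp (- x)\<close> turns convergence of Laplace transforms at the natural
  numbers into convergence of moments on \<open>[0, 1]\<close>, where polynomials are dense.\<close>
lemma tendsto_expectation_of_laplace:
  fixes p :: "nat \<Rightarrow> 'a pmf" and q :: "'b pmf" and X :: "nat \<Rightarrow> 'a \<Rightarrow> real" and Y :: "'b \<Rightarrow> real"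
    and f :: "real \<Rightarrow> real"
  assumes X: "\<And>n x. X n x \<ge> 0" and Y: "\<And>y. Y y \<ge> 0"
    and laplace: "\<And>k :: nat. (\<lambda>n. measure_pmf.expectation (p n) (\<lambda>x. exp (- X n x) ^ k)) \<longlonglongrightarrow>
      measure_pmf.expectation q (\<lambda>y. exp (- Y y) ^ k)"
    and f: "continuous_on {0..} f" "(f \<longlongrightarrow> 0) at_top"
  shows "(\<lambda>n. measure_pmf.expectation (p n) (\<lambda>x. f (X n x))) \<longlonglongrightarrow> measure_pmf.expectation q (\<lambda>y. f (Y y))"
proof (rule LIMSEQ_I)
  fix e :: real assume e: "e > 0"
  \<comment> \<open>\<open>h\<close> is \<open>f\<close> in the variable
    \<open>u = exp (- x)\<close>; the value at 0 is the limit of \<open>f\<close> at infinity, which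
    makes \<open>h\<close> continuous on the closed interval.\<close>
  define h where "h u = (if u = 0 then 0 else f (- ln u))" for u :: real
  have h_exp: "h (exp (- x)) = f x" for x
    by (simp add: h_def)
  have "continuous_on {0..1} h"
  proof (unfold continuous_on_eq_continuous_within, safe)
    fix u :: real assume u: "u \<in> {0..1}"
    show "continuous (at u within {0..1}) h"
    proof (cases "u = 0")
      case False
      have "continuous_on {0<..1} (\<lambda>u. f (- ln u))"
        by (rule continuous_on_compose2[OF f(1)]) (auto intro!: continuous_intros)
      then have "continuous_on {0<..1} h"
        by (rule continuous_on_eq) (auto simp: h_def)
      then have "continuous (at u within {0<..1}) h"
        using u False by (auto simp: continuous_on_eq_continuous_within)
      moreover have "at u within {0<..1} = at u within {0..1}"
        by (rule at_within_nhd[of _ "{0<..}"]) (use u False in auto)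
      ultimately show ?thesis by (simp add: continuous_within)
    next
      case True
      have "filterlim (\<lambda>u :: real. - ln u) at_top (at_right 0)"
        using ln_at_0 by (simp add: filterlim_uminus_at_top)
      then have "((\<lambda>u. f (- ln u)) \<longlongrightarrow> 0) (at_right 0)"
        by (rule filterlim_compose[OF f(2)])
      then have "(h \<longlongrightarrow> 0) (at_right 0)"
        by (rule Lim_transform_eventually) (auto simp: h_def eventually_at_filter)
      then have "(h \<longlongrightarrow> 0) (at 0 within {0..1})"
        by (simp add: at_within_Icc_at_right)
      then show ?thesis
        using True by (simp add: continuous_within h_def)
    qed
  qed
  \<comment> \<open>Replacing \<open>f\<close> by the polynomial costs at most \<open>e / 4\<close>
    on each side, and the polynomial expectations are eventually within
    \<open>e / 4\<close>.\<close>
  then obtain g where g: "real_polynomial_function g" "\<And>u. u \<in> {0..1} \<Longrightarrow> \<bar>h u - g u\<bar> < e / 4"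
    using Stone_Weierstrass_real_polynomial_function[of "{0..1::real}" h "e / 4"] e by auto
  then obtain a N where g_eq: "g = (\<lambda>u. \<Sum>i\<le>N. a i * u ^ i)"
    by (auto simp: real_polynomial_function_iff_sum)
  have bound: "\<bar>exp (- x) ^ i\<bar> \<le> 1" if "x \<ge> 0" for x :: real and i :: nat
    using that by (simp add: power_le_one)
  have g_expectation: "measure_pmf.expectation r (\<lambda>x. g (exp (- Z x))) =
      (\<Sum>i\<le>N. a i * measure_pmf.expectation r (\<lambda>x. exp (- Z x) ^ i))"
    and g_integrable: "integrable (measure_pmf r) (\<lambda>x. g (exp (- Z x)))"
    if "\<And>x. Z x \<ge> 0" for r :: "'c pmf" and Z
  proof -
    have "integrable (measure_pmf r) (\<lambda>x. exp (- Z x) ^ i)" for i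
      by (rule integrable_measure_pmf_bounded[of _ 1]) (rule bound[OF that])
    then show "measure_pmf.expectation r (\<lambda>x. g (exp (- Z x))) =
        (\<Sum>i\<le>N. a i * measure_pmf.expectation r (\<lambda>x. exp (- Z x) ^ i))"
      "integrable (measure_pmf r) (\<lambda>x. g (exp (- Z x)))"
      unfolding g_eq by simp_all
  qed
  have close: "\<bar>measure_pmf.expectation r (\<lambda>x. f (Z x)) - measure_pmf.expectation r (\<lambda>x. g (exp (- Z x)))\<bar> \<le> e / 4"
    if Z: "\<And>x. Z x \<ge> 0" for r :: "'c pmf" and Z
  proof (rule pmf_expectation_diff_le)
    show diff: "\<bar>f (Z x) - g (exp (- Z x))\<bar> \<le> e / 4" for x
      using g(2)[of "exp (- Z x)"] Z[of x] by (simp add: h_exp)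
    show gi: "integrable (measure_pmf r) (\<lambda>x. g (exp (- Z x)))"
      by (rule g_integrable[OF Z])
    \<comment> \<open>Integrability of \<open>f (Z x)\<close> follows from its bounded distance to
      the integrable polynomial.\<close>
    have "integrable (measure_pmf r) (\<lambda>x. (f (Z x) - g (exp (- Z x))) + g (exp (- Z x)))"
      by (intro Bochner_Integration.integrable_add integrable_measure_pmf_bounded[OF diff] gi)
    then show "integrable (measure_pmf r) (\<lambda>x. f (Z x))" by simp
  qed
  have "(\<lambda>n. measure_pmf.expectation (p n) (\<lambda>x. g (exp (- X n x)))) \<longlonglongrightarrow>
      measure_pmf.expectation q (\<lambda>y. g (exp (- Y y)))"
    unfolding g_expectation[OF X] g_expectation[OF Y] by (intro tendsto_intros laplace)
  from LIMSEQ_D[OF this, of "e / 4"] obtain n0 where n0: "\<And>n. n \<ge> n0 \<Longrightarrow> \<bar>measure_pmf.expectation (p n) (\<lambda>x. g (exp (- X n x))) -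
      measure_pmf.expectation q (\<lambda>y. g (exp (- Y y)))\<bar> < e / 4"
    unfolding real_norm_def using e by (metis divide_pos_pos zero_less_numeral)
  show "\<exists>n0. \<forall>n\<ge>n0. norm (measure_pmf.expectation (p n) (\<lambda>x. f (X n x)) - measure_pmf.expectation q (\<lambda>y. f (Y y))) < e"
  proof (intro exI[of _ n0] allI impI)
    fix n assume "n \<ge> n0"
    then show "norm (measure_pmf.expectation (p n) (\<lambda>x. f (X n x)) - measure_pmf.expectation q (\<lambda>y. f (Y y))) < e"
      using n0[of n] close[of "X n" "p n", OF X] close[of Y q, OF Y] e
      unfolding real_norm_def by linarith
  qed
qed

section \<open>Expectations under the Poisson law\<close>

lemma expectation_poisson_pmf:
  fixes f :: "nat \<Rightarrow> real"
  assumes r: "r > 0" and B: "\<And>k. \<bar>f k\<bar> \<le> B"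
  shows "measure_pmf.expectation (poisson_pmf r) f = (\<Sum>k. r ^ k / fact k * exp (- r) * f k)"
proof -
  have i: "integrable (measure_pmf (poisson_pmf r)) f"
    by (rule integrable_measure_pmf_bounded[OF B])
  have "integrable (count_space UNIV) (\<lambda>k. r ^ k / fact k * exp (- r) * f k)"
    using i r unfolding measure_pmf_eq_density by (subst (asm) integrable_density) auto
  moreover have "measure_pmf.expectation (poisson_pmf r) f = (\<integral>k. r ^ k / fact k * exp (- r) * f k \<partial>count_space UNIV)"
    using r unfolding measure_pmf_eq_density by (subst integral_density) auto
  ultimately show ?thesis
    by (simp add: integral_count_space_nat)
qed

lemma laplace_poisson_pmf:
  assumes r: "r > 0" and t: "t \<ge> 0"
  shows "measure_pmf.expectation (poisson_pmf r) (\<lambda>k. exp (- (t * real k))) = exp (- (r * (1 - exp (- t))))"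
proof -
  have "\<bar>exp (- (t * real k))\<bar> \<le> 1" for k using t by simp
  then have "measure_pmf.expectation (poisson_pmf r) (\<lambda>k. exp (- (t * real k))) =
      (\<Sum>k. r ^ k / fact k * exp (- r) * exp (- (t * real k)))"
    by (rule expectation_poisson_pmf[OF r])
  also have "\<dots> = (\<Sum>k. exp (- r) * ((r * exp (- t)) ^ k /\<^sub>R fact k))"
    by (simp add: power_mult_distrib exp_of_nat_mult[symmetric] field_simps)
  also have "\<dots> = exp (- r) * (\<Sum>k. (r * exp (- t)) ^ k /\<^sub>R fact k)"
    by (rule suminf_mult[OF summable_exp_generic])
  also have "\<dots> = exp (- r) * exp (r * exp (- t))"
    by (simp add: exp_def)
  finally show ?thesis
    by (simp add: exp_add[symmetric] algebra_simps)
qed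

section \<open>Pulse coincidences of two signatures\<close>

definition hit :: "(nat \<Rightarrow> nat \<times> bool) \<Rightarrow> (nat \<Rightarrow> nat \<times> bool) \<Rightarrow> nat \<Rightarrow> real" where
  "hit c c' m = of_bool (fst (c' m) = fst (c m))"

lemma hit_cases: "hit c c' m = 0 \<or> hit c c' m = 1"
  by (simp add: hit_def)

text \<open>Blocks are independent and positions uniform, so each block of \<open>A\<close> is hit
  with probability \<open>1 / Nh\<close>. The value does not depend on \<open>c\<close>, which is
  the source of the uniformity in the first signature.\<close>

lemma expectation_prod_hit:
  assumes Nh: "Nh \<ge> 1" and c: "\<And>m. m < Ns \<Longrightarrow> fst (c m) < Nh" and A: "A \<subseteq> {..<Ns}"
  shows "measure_pmf.expectation (choice_pmf Ns Nh) (\<lambda>c'. \<Prod>m\<in>A. hit c c' m) = (1 / real Nh) ^ card A"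
proof -
  let ?q = "pair_pmf (pmf_of_set {..<Nh}) (pmf_of_set (UNIV :: bool set))"
  \<comment> \<open>Padding with the factor 1 outside \<open>A\<close> turns the product into one
    over all blocks, which independence factorises.\<close>
  define F where "F m x = (if m \<in> A then of_bool (fst x = fst (c m)) else 1 :: real)" for m and x :: "nat \<times> bool"
  have single: "measure_pmf.expectation ?q (\<lambda>x. of_bool (fst x = k) :: real) = 1 / real Nh" if "k < Nh" for k
  proof -
    have "measure_pmf.expectation ?q (\<lambda>x. of_bool (fst x = k) :: real) =
        measure_pmf.expectation (map_pmf fst ?q) (\<lambda>y. of_bool (y = k) :: real)"
      by simp
    also have "\<dots> = measure_pmf.expectation (pmf_of_set {..<Nh}) (\<lambda>y. of_bool (y = k) :: real)"
      by (simp only: map_fst_pair_pmf)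
    also have "\<dots> = (\<Sum>y<Nh. of_bool (y = k)) / real Nh"
      using Nh by (subst integral_pmf_of_set) (auto simp: lessThan_empty_iff)
    also have "\<dots> = 1 / real Nh"
      using that by simp
    finally show ?thesis .
  qed
  have "measure_pmf.expectation (choice_pmf Ns Nh) (\<lambda>c'. \<Prod>m\<in>A. hit c c' m) =
      measure_pmf.expectation (choice_pmf Ns Nh) (\<lambda>c'. \<Prod>m<Ns. F m (c' m))"
    using A by (intro arg_cong[where f = "measure_pmf.expectation _"] ext)
      (simp add: F_def hit_def prod.If_cases Int_absorb1)
  also have "\<dots> = (\<Prod>m<Ns. measure_pmf.expectation ?q (F m))"
    unfolding choice_pmf_def
    by (intro expectation_prod_Pi_pmf integrable_measure_pmf_bounded[of _ 1]) (auto simp: F_def)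
  also have "\<dots> = (\<Prod>m<Ns. if m \<in> A then 1 / real Nh else 1)"
    by (intro prod.cong refl) (simp add: F_def[abs_def] single c)
  also have "\<dots> = (1 / real Nh) ^ card A"
    using A by (simp add: prod.If_cases Int_absorb1)
  finally show ?thesis .
qed

text \<open>With at most one hit the squared correlation is \<open>0\<close> or \<open>1 / Ns\<^sup>2\<close>, so the left-hand side vanishes;
  \<open>H * (H - 1)\<close> pays for the rare case of two or more hits.\<close>
lemma correlation_laplace_pointwise:
  assumes Ns: "Ns \<ge> 1" and c: "\<And>m. m < Ns \<Longrightarrow> fst (c m) < Nh" and t: "t \<ge> 0"
  defines "H \<equiv> \<lambda>c'. \<Sum>m<Ns. hit c c' m"
  shows "\<bar>(1 - exp (- (t * (\<Sum>i<Ns * Nh. seq_of Ns Nh c i * seq_of Ns Nh c' i)\<^sup>2))) -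
      H c' * (1 - exp (- (t / (real Ns)\<^sup>2)))\<bar> \<le> H c' * (H c' - 1)"
proof -
  let ?y = "\<Sum>i<Ns * Nh. seq_of Ns Nh c i * seq_of Ns Nh c' i"
  define A where "A = {m \<in> {..<Ns}. fst (c m) = fst (c' m)}"
  have H: "H c' = real (card A)"
    unfolding H_def hit_def A_def by (simp add: of_bool_def sum.If_cases Int_def eq_commute)
  have y: "?y = (\<Sum>m\<in>A. (if snd (c m) = snd (c' m) then 1 else - 1) / real Ns)"
  proof -
    have "?y = (\<Sum>m<Ns. if fst (c m) = fst (c' m) then (if snd (c m) = snd (c' m) then 1 else - 1) / real Ns else 0)"
      by (rule sum_seq_of_mult) (rule c)
    then show ?thesis
      unfolding A_def by (subst sum.inter_filter) simp_all
  qed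
  let ?d = "1 - exp (- (t / (real Ns)\<^sup>2))"
  have d: "0 \<le> ?d" "?d \<le> 1" using t by simp_all
  consider "card A = 0" | "card A = 1" | "card A \<ge> 2" by linarith
  then show ?thesis
  proof cases
    case 1
    then have "A = {}" by (simp add: A_def)
    then show ?thesis unfolding y H by simp
  next
    case 2
    then obtain m where "A = {m}" by (auto simp: card_1_singleton_iff)
    then have "?y\<^sup>2 = 1 / (real Ns)\<^sup>2" unfolding y by (simp add: power_divide)
    then show ?thesis unfolding H 2 by simp
  next
    case 3
    \<comment> \<open>The two compared quantities lie in \<open>[0, 1]\<close> and
      \<open>[0, H c']\<close>, so they differ by at most \<open>H c'\<close>, which is at most
      \<open>H c' * (H c' - 1)\<close> once \<open>H c'\<close> is at least 2.\<close>
    have e: "0 \<le> 1 - exp (- (t * ?y\<^sup>2))" "1 - exp (- (t * ?y\<^sup>2)) \<le> 1"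
      using t by simp_all
    have "0 \<le> H c' * ?d" "H c' * ?d \<le> H c' * 1"
      using d unfolding H by (intro mult_nonneg_nonneg mult_left_mono; simp)+
    moreover have "2 \<le> H c'"
      using 3 unfolding H by linarith
    moreover from this have "H c' * 1 \<le> H c' * (H c' - 1)"
      by (intro mult_left_mono) auto
    ultimately show ?thesis
      using e by linarith
  qed
qed

lemma abs_one_minus_exp_le:
  fixes a :: real assumes "a \<ge> 0" shows "\<bar>1 - a - exp (- a)\<bar> \<le> a\<^sup>2"
proof -
  have "1 + a \<le> exp a" by (rule exp_ge_add_one_self)
  then have "exp (- a) \<le> 1 / (1 + a)"
    using assms by (simp add: exp_minus field_simps)
  \<comment> \<open>Here \<open>(1 + a) * (1 - a + a\<^sup>2)\<close> equals
    \<open>1 + a ^ 3\<close>.\<close>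
  also have "\<dots> \<le> 1 - a + a\<^sup>2"
    using assms by (simp add: divide_le_eq) (simp add: algebra_simps power2_eq_square)
  finally have "exp (- a) \<le> 1 - a + a\<^sup>2" .
  moreover have "1 - a \<le> exp (- a)"
    using exp_ge_add_one_self[of "- a"] by simp
  ultimately show ?thesis by linarith
qed

text \<open>Comparing with an exponential instead of \<open>1 - ?a\<close> makes the later power
  over the interferers exact. One half of the factor 2 pays for replacing the correlation by the
  number of hits, the other for replacing \<open>1 - ?a\<close> by
  \<open>exp (- ?a)\<close>.\<close>

lemma correlation_laplace:
  assumes Ns: "Ns \<ge> 1" and Nh: "Nh \<ge> 1" and c: "\<And>m. m < Ns \<Longrightarrow> fst (c m) < Nh" and t: "t \<ge> 0"
  shows "\<bar>measure_pmf.expectation (NsNh_seq Ns Nh) (\<lambda>s. exp (- (t * (\<Sum>i<Ns * Nh. seq_of Ns Nh c i * s i)\<^sup>2)))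
    - exp (- (real Ns / real Nh * (1 - exp (- (t / (real Ns)\<^sup>2)))))\<bar> \<le> 2 * (real Ns / real Nh)\<^sup>2"
proof -
  define H where "H c' = (\<Sum>m<Ns. hit c c' m)" for c'
  let ?p = "choice_pmf Ns Nh"
  let ?e = "\<lambda>c'. exp (- (t * (\<Sum>i<Ns * Nh. seq_of Ns Nh c i * seq_of Ns Nh c' i)\<^sup>2))"
  let ?d = "1 - exp (- (t / (real Ns)\<^sup>2))"
  let ?a = "real Ns / real Nh * ?d"
  have fin: "integrable (measure_pmf ?p) f" for f :: "_ \<Rightarrow> real"
    by (rule integrable_measure_pmf_finite[OF finite_set_choice_pmf[OF Nh]])
  have EH: "measure_pmf.expectation ?p H = real Ns / real Nh"
  proof -
    have "measure_pmf.expectation ?p H = (\<Sum>m<Ns. measure_pmf.expectation ?p (\<lambda>c'. \<Prod>m\<in>{m}. hit c c' m))"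
      unfolding H_def[abs_def] by (simp add: fin)
    also have "\<dots> = (\<Sum>m<Ns. 1 / real Nh)"
      by (intro sum.cong refl, subst expectation_prod_hit[OF Nh c]) auto
    finally show ?thesis by simp
  qed
  have EH2: "measure_pmf.expectation ?p (\<lambda>c'. H c' * (H c' - 1)) \<le> (real Ns / real Nh)\<^sup>2"
  proof -
    \<comment> \<open>The second factorial moment counts ordered pairs of distinct blocks that are
      both hit: fewer than \<open>Ns\<^sup>2\<close> pairs, or none, each of probability
      \<open>1 / Nh\<^sup>2\<close>. Since a hit is 0 or 1, \<open>h * (H - h)\<close> equals
      \<open>h * (H - 1)\<close>.\<close>
    have "H c' * (H c' - 1) = (\<Sum>m<Ns. \<Sum>m'\<in>{..<Ns} - {m}. \<Prod>k\<in>{m, m'}. hit c c' k)" for c'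
    proof -
      have "(\<Sum>m<Ns. \<Sum>m'\<in>{..<Ns} - {m}. \<Prod>k\<in>{m, m'}. hit c c' k) =
         (\<Sum>m<Ns. hit c c' m * (\<Sum>m'\<in>{..<Ns} - {m}. hit c c' m'))"
        unfolding sum_distrib_left by (intro sum.cong refl) auto
      also have "\<dots> = (\<Sum>m<Ns. hit c c' m * (H c' - 1))"
      proof (intro sum.cong refl)
        fix m assume "m \<in> {..<Ns}"
        then have "(\<Sum>m'\<in>{..<Ns} - {m}. hit c c' m') = H c' - hit c c' m"
          unfolding H_def by (subst sum_diff1) auto
        then show "hit c c' m * (\<Sum>m'\<in>{..<Ns} - {m}. hit c c' m') = hit c c' m * (H c' - 1)"
          using hit_cases[of c c' m] by auto
      qed
      also have "\<dots> = H c' * (H c' - 1)"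
        by (simp add: H_def sum_distrib_right)
      finally show ?thesis by simp
    qed
    then have "measure_pmf.expectation ?p (\<lambda>c'. H c' * (H c' - 1)) =
        (\<Sum>m<Ns. \<Sum>m'\<in>{..<Ns} - {m}. measure_pmf.expectation ?p (\<lambda>c'. \<Prod>k\<in>{m, m'}. hit c c' k))"
      by (simp add: fin)
    also have "\<dots> = (\<Sum>m<Ns. \<Sum>m'\<in>{..<Ns} - {m}. (1 / real Nh)\<^sup>2)"
      by (intro sum.cong refl, subst expectation_prod_hit[OF Nh c]) (auto simp: card_insert_if power2_eq_square)
    also have "\<dots> \<le> (\<Sum>m<Ns. real Ns * (1 / real Nh)\<^sup>2)"
      by (intro sum_mono) (simp add: card_Diff_subset mult_right_mono)
    also have "\<dots> = (real Ns / real Nh)\<^sup>2"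
      by (simp add: power2_eq_square)
    finally show ?thesis .
  qed
  have triangle: "\<bar>x - y\<bar> \<le> B \<Longrightarrow> \<bar>x - z\<bar> \<le> B \<Longrightarrow> \<bar>y - z\<bar> \<le> 2 * B" for x y z B :: real
    by linarith
  have "\<bar>measure_pmf.expectation ?p (\<lambda>c'. (1 - ?e c') - H c' * ?d)\<bar> \<le>
      measure_pmf.expectation ?p (\<lambda>c'. \<bar>(1 - ?e c') - H c' * ?d\<bar>)"
    by (rule integral_abs_bound)
  also have "\<dots> \<le> measure_pmf.expectation ?p (\<lambda>c'. H c' * (H c' - 1))"
    using correlation_laplace_pointwise[OF Ns c t] unfolding H_def
    by (intro integral_mono fin) auto
  also note EH2
  also have "measure_pmf.expectation ?p (\<lambda>c'. (1 - ?e c') - H c' * ?d) =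
      (1 - ?a) - measure_pmf.expectation ?p ?e"
    by (simp add: fin EH)
  finally have "\<bar>(1 - ?a) - measure_pmf.expectation ?p ?e\<bar> \<le> (real Ns / real Nh)\<^sup>2" .
  moreover have "\<bar>1 - ?a - exp (- ?a)\<bar> \<le> (real Ns / real Nh)\<^sup>2"
  proof -
    have d: "0 \<le> ?d" "?d \<le> 1" using t by simp_all
    have "\<bar>1 - ?a - exp (- ?a)\<bar> \<le> ?a\<^sup>2"
      using d by (intro abs_one_minus_exp_le mult_nonneg_nonneg) auto
    also have "\<dots> \<le> (real Ns / real Nh)\<^sup>2"
      using d by (intro power_mono mult_left_le mult_nonneg_nonneg) auto
    finally show ?thesis .
  qed
  ultimately have "\<bar>measure_pmf.expectation ?p ?e - exp (- ?a)\<bar> \<le> 2 * (real Ns / real Nh)\<^sup>2"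
    by (rule triangle)
  then show ?thesis
    by (simp add: NsNh_seq_eq)
qed

text \<open>Given the first signature \<open>s\<close>, the transform is exactly
  \<open>?X s ^ (K - 1)\<close>. Numbers of modulus at most 1 satisfy
  \<open>|x ^ n - y ^ n| \<le> n * |x - y|\<close>; as the estimate for \<open>?X s\<close> holds
  for every \<open>s\<close> in the support, the bound survives averaging over
  \<open>s\<close>.\<close>

lemma interference_laplace:
  assumes Ns: "Ns \<ge> 1" and Nh: "Nh \<ge> 1" and K: "K \<ge> 1" and t: "t \<ge> 0"
  shows "\<bar>measure_pmf.expectation (spread_pmf Ns Nh K) (\<lambda>S. exp (- (t * interference (Ns * Nh) K S)))
    - exp (- (real Ns / real Nh * (1 - exp (- (t / (real Ns)\<^sup>2))))) ^ (K - 1)\<bar>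
    \<le> real (K - 1) * (2 * (real Ns / real Nh)\<^sup>2)"
proof -
  let ?q = "NsNh_seq Ns Nh" and ?N = "Ns * Nh"
  let ?L = "exp (- (real Ns / real Nh * (1 - exp (- (t / (real Ns)\<^sup>2)))))"
  let ?B = "real (K - 1) * (2 * (real Ns / real Nh)\<^sup>2)"
  let ?P = "Pi_pmf {1..<K} (\<lambda>_. 0) (\<lambda>_. ?q)"
  let ?X = "\<lambda>s. measure_pmf.expectation ?q (\<lambda>s'. exp (- (t * (\<Sum>i<?N. s i * s' i)\<^sup>2)))"
  have finq: "finite (set_pmf ?q)"
    using Nh by (simp add: NsNh_seq_eq finite_set_choice_pmf)
  have finP: "finite (set_pmf ?P)"
    using finq by (auto simp: set_Pi_pmf intro!: finite_PiE_dflt)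
  have spread: "spread_pmf Ns Nh K = ?q \<bind> (\<lambda>s. map_pmf (\<lambda>f. f(0 := s)) ?P)"
  proof -
    have "{..<K} = insert 0 {1..<K}" using K by auto
    then show ?thesis
      unfolding spread_pmf_def by (simp add: Pi_pmf_insert' map_pmf_def)
  qed
  have "measure_pmf.expectation (spread_pmf Ns Nh K) (\<lambda>S. exp (- (t * interference ?N K S))) =
    (\<Sum>s\<in>set_pmf ?q. pmf ?q s * measure_pmf.expectation ?P (\<lambda>f. exp (- (t * interference ?N K (f(0 := s))))))"
    unfolding spread by (subst pmf_expectation_bind[OF finq]) (use finP in simp_all)
  also have "\<dots> = (\<Sum>s\<in>set_pmf ?q. pmf ?q s * ?X s ^ (K - 1))"
  proof (intro sum.cong refl arg_cong[where f = "(*) _"])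
    fix s
    have "exp (- (t * interference ?N K (f(0 := s)))) = (\<Prod>j\<in>{1..<K}. exp (- (t * (\<Sum>i<?N. s i * f j i)\<^sup>2)))" for f
      by (simp add: interference_def correlation_def sum_distrib_left sum_negf flip: exp_sum)
    then have "measure_pmf.expectation ?P (\<lambda>f. exp (- (t * interference ?N K (f(0 := s))))) =
        measure_pmf.expectation ?P (\<lambda>f. \<Prod>j\<in>{1..<K}. exp (- (t * (\<Sum>i<?N. s i * f j i)\<^sup>2)))"
      by simp
    also have "\<dots> = (\<Prod>j\<in>{1..<K}. ?X s)"
      by (rule expectation_prod_Pi_pmf) (auto intro!: integrable_measure_pmf_finite finq)
    finally show "measure_pmf.expectation ?P (\<lambda>f. exp (- (t * interference ?N K (f(0 := s))))) = ?X s ^ (K - 1)"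
      by simp
  qed
  also have "\<dots> = measure_pmf.expectation ?q (\<lambda>s. ?X s ^ (K - 1))"
    using finq by (subst integral_measure_pmf[OF finq]) auto
  finally have eq: "measure_pmf.expectation (spread_pmf Ns Nh K) (\<lambda>S. exp (- (t * interference ?N K S))) =
    measure_pmf.expectation ?q (\<lambda>s. ?X s ^ (K - 1))" .
  have "\<bar>measure_pmf.expectation ?q (\<lambda>s. ?X s ^ (K - 1)) - measure_pmf.expectation ?q (\<lambda>_. ?L ^ (K - 1))\<bar> \<le> ?B"
  proof (rule pmf_expectation_diff_le)
    fix s assume "s \<in> set_pmf ?q"
    then obtain c where c: "c \<in> set_pmf (choice_pmf Ns Nh)" "s = seq_of Ns Nh c"
      by (auto simp: NsNh_seq_eq)
    have "?X s \<ge> 0" by (rule Bochner_Integration.integral_nonneg) simp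
    moreover have "?X s \<le> measure_pmf.expectation ?q (\<lambda>_. 1)"
      using t by (intro integral_mono integrable_measure_pmf_finite finq) auto
    ultimately have "norm (?X s) \<le> 1" by simp
    moreover have "norm ?L \<le> 1"
      using t by simp
    ultimately have "norm (?X s ^ (K - 1) - ?L ^ (K - 1)) \<le> real (K - 1) * norm (?X s - ?L)"
      by (rule norm_power_diff)
    also have "\<dots> \<le> ?B"
      using correlation_laplace[OF Ns Nh choice_pmf_less[OF Nh c(1)] t]
      unfolding c(2) by (intro mult_left_mono) auto
    finally show "\<bar>?X s ^ (K - 1) - ?L ^ (K - 1)\<bar> \<le> ?B" by simp
  qed (intro integrable_measure_pmf_finite finq)+
  then show ?thesis
    unfolding eq by simp
qed

lemma tendsto_interference_laplace:
  assumes Ns: "Ns \<ge> 1" and \<beta>: "\<beta> > 0" and K: "\<And>Nh. K Nh \<ge> 1" and t: "t \<ge> 0"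
    and lim: "(\<lambda>Nh. real (K Nh) / real (Ns * Nh)) \<longlonglongrightarrow> \<beta>"
  shows "(\<lambda>Nh. measure_pmf.expectation (spread_pmf Ns Nh (K Nh)) (\<lambda>S. exp (- (t * interference (Ns * Nh) (K Nh) S))))
    \<longlonglongrightarrow> exp (- ((real Ns)\<^sup>2 * \<beta> * (1 - exp (- (t / (real Ns)\<^sup>2)))))"
proof -
  let ?d = "1 - exp (- (t / (real Ns)\<^sup>2))"
  let ?L = "\<lambda>Nh. exp (- (real Ns / real Nh * ?d)) ^ (K Nh - 1)"
  have inv: "(\<lambda>Nh. 1 / real Nh) \<longlonglongrightarrow> 0" by (rule lim_const_over_n)
  \<comment> \<open>One factor \<open>Ns\<close> is the number of blocks, the other comes from
    \<beta> being the load per chip with \<open>Ns * Nh\<close> chips. Leaving out the desired user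
    costs \<open>Ns / Nh\<close>, which vanishes.\<close>
  have K1: "(\<lambda>Nh. real (K Nh - 1) * (real Ns / real Nh)) \<longlonglongrightarrow> (real Ns)\<^sup>2 * \<beta>"
  proof -
    have "(\<lambda>Nh. (real Ns)\<^sup>2 * (real (K Nh) / real (Ns * Nh)) - real Ns * (1 / real Nh)) \<longlonglongrightarrow> (real Ns)\<^sup>2 * \<beta> - real Ns * 0"
      by (intro tendsto_intros lim inv)
    moreover have "(real Ns)\<^sup>2 * (real (K Nh) / real (Ns * Nh)) - real Ns * (1 / real Nh) = real (K Nh - 1) * (real Ns / real Nh)" for Nh
      \<comment> \<open>At \<open>Nh = 0\<close> both sides are 0 by the convention for division by
        zero.\<close>
      using K[of Nh] Ns by (cases "Nh = 0") (auto simp: of_nat_diff field_simps power2_eq_square)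
    ultimately show ?thesis by simp
  qed
  have "(\<lambda>Nh. exp (- (real (K Nh - 1) * (real Ns / real Nh) * ?d))) \<longlonglongrightarrow> exp (- ((real Ns)\<^sup>2 * \<beta> * ?d))"
    by (intro tendsto_intros K1)
  then have L: "?L \<longlonglongrightarrow> exp (- ((real Ns)\<^sup>2 * \<beta> * ?d))"
    by (simp add: exp_of_nat_mult[symmetric] mult.assoc)
  \<comment> \<open>The total error is the convergent quantity of \<open>K1\<close> times
    \<open>2 * Ns / Nh\<close>.\<close>
  have B: "(\<lambda>Nh. real (K Nh - 1) * (2 * (real Ns / real Nh)\<^sup>2)) \<longlonglongrightarrow> 0"
  proof -
    have "(\<lambda>Nh. (real (K Nh - 1) * (real Ns / real Nh)) * (2 * real Ns * (1 / real Nh))) \<longlonglongrightarrow> (real Ns)\<^sup>2 * \<beta> * (2 * real Ns * 0)"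
      by (intro tendsto_intros K1 inv)
    then show ?thesis by (simp add: power2_eq_square field_simps)
  qed
  have "(\<lambda>Nh. measure_pmf.expectation (spread_pmf Ns Nh (K Nh)) (\<lambda>S. exp (- (t * interference (Ns * Nh) (K Nh) S))) - ?L Nh) \<longlonglongrightarrow> 0"
    by (rule Lim_null_comparison[OF _ B])
      (use interference_laplace[OF Ns _ K t] in \<open>auto simp: eventually_sequentially intro!: exI[of _ 1]\<close>)
  from tendsto_add[OF this L] show ?thesis by simp
qed

theorem theorem3:
  fixes Ns :: nat and \<beta> \<gamma> E N0 :: real and K :: "nat \<Rightarrow> nat"
  assumes "Ns \<ge> 1" and "\<beta> > 0" and "E > 0" and "N0 > 0" and "\<gamma> = E / N0"
    and "\<And>Nh. K Nh \<ge> 1"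
    and "(\<lambda>Nh. real (K Nh) / real (Ns * Nh)) \<longlonglongrightarrow> \<beta>"
  shows "(\<lambda>Nh. \<beta> * MI_mf Ns Nh (K Nh) E N0) \<longlonglongrightarrow> I_sumf_TH \<beta> \<gamma> Ns"
proof -
  define r where "r = (real Ns)\<^sup>2 * \<beta>"
  define f where "f x = log 2 (1 + \<gamma> / (1 + x * \<gamma>))" for x :: real
  define Q where "Q Nh = interference (Ns * Nh) (K Nh)" for Nh
  have r: "r > 0" using assms by (simp add: r_def)
  have \<gamma>: "\<gamma> > 0" using assms by simp
  have MI: "MI_mf Ns Nh (K Nh) E N0 = measure_pmf.expectation (spread_pmf Ns Nh (K Nh)) (\<lambda>S. f (Q Nh S))"
    if Nh: "Nh \<ge> 1" for Nh
  proof -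
    have "(noise_var (Ns * Nh) (K Nh) E N0 S + E) / noise_var (Ns * Nh) (K Nh) E N0 S = 1 + \<gamma> / (1 + Q Nh S * \<gamma>)" for S
    proof -
      have "noise_var (Ns * Nh) (K Nh) E N0 S = N0 * (1 + Q Nh S * \<gamma>)"
        using assms by (simp add: noise_var_def Q_def field_simps)
      moreover have "1 + Q Nh S * \<gamma> > 0"
        using interference_nonneg[of "Ns * Nh" "K Nh" S] \<gamma> by (simp add: Q_def add_pos_nonneg)
      ultimately show ?thesis
        using assms(4) by (simp add: assms(5) add_divide_distrib)
    qed
    then show ?thesis
      unfolding MI_mf_eq_sum[OF assms(1) Nh assms(6) assms(3,4)]
      by (subst integral_measure_pmf[OF finite_set_spread_pmf[OF Nh]]) (auto simp: f_def)
  qed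
  have f_cont: "continuous_on {0..} f"
    unfolding f_def using \<gamma> by (intro continuous_intros) (auto simp: add_nonneg_eq_0_iff add_pos_nonneg add_pos_pos intro!: order.strict_implies_not_eq[symmetric])
  have f_lim: "(f \<longlongrightarrow> 0) at_top"
  proof -
    have "filterlim (\<lambda>x. 1 + x * \<gamma>) at_top at_top"
      using \<gamma> by (intro filterlim_tendsto_add_at_top[OF tendsto_const]
        filterlim_at_top_mult_tendsto_pos[OF tendsto_const _ filterlim_ident])
    then have "((\<lambda>x. 1 + \<gamma> / (1 + x * \<gamma>)) \<longlongrightarrow> 1 + 0) at_top"
      by (intro tendsto_intros tendsto_divide_0[OF tendsto_const] filterlim_at_top_imp_at_infinity)
    then have "((\<lambda>x. log 2 (1 + \<gamma> / (1 + x * \<gamma>))) \<longlongrightarrow> log 2 1) at_top"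
      by (intro tendsto_log tendsto_const) auto
    then show ?thesis by (simp add: f_def[abs_def])
  qed
  have "(\<lambda>Nh. measure_pmf.expectation (spread_pmf Ns Nh (K Nh)) (\<lambda>S. f (Q Nh S))) \<longlonglongrightarrow>
      measure_pmf.expectation (poisson_pmf r) (\<lambda>k. f (real k / (real Ns)\<^sup>2))"
  proof (rule tendsto_expectation_of_laplace[OF _ _ _ f_cont f_lim])
    fix k :: nat
    \<comment> \<open>The \<open>k\<close>-th moment of \<open>exp (- Q)\<close> is the Laplace
      transform at \<open>t = k\<close>; on the Poisson side the scaling by
      \<open>Ns\<^sup>2\<close> moves into the argument.\<close>
    have "(\<lambda>Nh. measure_pmf.expectation (spread_pmf Ns Nh (K Nh)) (\<lambda>S. exp (- (real k * Q Nh S)))) \<longlonglongrightarrow>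
        exp (- (r * (1 - exp (- (real k / (real Ns)\<^sup>2)))))"
      unfolding Q_def r_def using tendsto_interference_laplace[OF assms(1,2,6) _ assms(7), of "real k"] by simp
    moreover have "measure_pmf.expectation (poisson_pmf r) (\<lambda>y. exp (- (real y / (real Ns)\<^sup>2)) ^ k) =
        exp (- (r * (1 - exp (- (real k / (real Ns)\<^sup>2)))))"
      using laplace_poisson_pmf[OF r, of "real k / (real Ns)\<^sup>2"]
      by (simp add: exp_of_nat_mult[symmetric])
    ultimately show "(\<lambda>Nh. measure_pmf.expectation (spread_pmf Ns Nh (K Nh)) (\<lambda>S. exp (- Q Nh S) ^ k)) \<longlonglongrightarrow>
        measure_pmf.expectation (poisson_pmf r) (\<lambda>y. exp (- (real y / (real Ns)\<^sup>2)) ^ k)"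
      by (simp add: exp_of_nat_mult[symmetric])
  qed (auto simp: Q_def interference_nonneg)
  moreover have "measure_pmf.expectation (poisson_pmf r) (\<lambda>k. f (real k / (real Ns)\<^sup>2)) =
      (\<Sum>k. r ^ k / fact k * exp (- r) * f (real k / (real Ns)\<^sup>2))"
  \<comment> \<open>The bound is the value of \<open>f\<close> without interference.\<close>
  proof (rule expectation_poisson_pmf[OF r, of _ "log 2 (1 + \<gamma>)"])
    fix k
    have "1 + \<gamma> / (1 + real k / (real Ns)\<^sup>2 * \<gamma>) \<le> 1 + \<gamma>"
      using \<gamma> by (simp add: divide_le_eq add_pos_nonneg)
    then show "\<bar>f (real k / (real Ns)\<^sup>2)\<bar> \<le> log 2 (1 + \<gamma>)"
      using \<gamma> unfolding f_def by (subst abs_of_nonneg) (auto simp: add_pos_nonneg)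
  qed
  ultimately have "(\<lambda>Nh. \<beta> * measure_pmf.expectation (spread_pmf Ns Nh (K Nh)) (\<lambda>S. f (Q Nh S))) \<longlonglongrightarrow> I_sumf_TH \<beta> \<gamma> Ns"
    unfolding I_sumf_TH_def r_def[symmetric] f_def[abs_def] by (intro tendsto_mult_left) simp
  then show ?thesis
    \<comment> \<open>The formula for the mutual information is available from \<open>Nh = 1\<close>
      on, which suffices for the limit.\<close>
    by (rule Lim_transform_eventually) (use MI in \<open>auto simp: eventually_sequentially intro!: exI[of _ 1]\<close>)
qed

end
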